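(* Let $\mathit{Prog}$ be any CLP program (in the setting described in the context, containing the nullary predicate $\mathtt{unsafe}$). Then the NLR strategy applied to $\mathit{Prog}$ terminates and produces a CLP program $\mathit{Prog}'$ such that $\mathtt{unsafe} \in \mathcal{M}(\mathit{Prog})$ if and only if $\mathtt{unsafe} \in \mathcal{M}(\mathit{Prog}')$.
   Context: A CLP program (set of constrained Horn clauses) is a finite set of clauses $\mathtt{H \,\text{:-}\, c, B_1,\dots,B_m}$, where $\mathtt{H}$ and the $\mathtt{B_i}$ are atoms and $\mathtt{c}$ is a constraint, i.e. a conjunction of atomic constraints in the theory $\mathcal{A}$ of linear integer arithmetic with integer arrays. $\mathcal{M}(P)$ denotes the least model of the program $P$; $\mathtt{unsafe}$ is a nullary predicate. Tuples of variables are identified with the sets of variables occurring in them; the union of two tuples is formed by erasing duplicates. Linking variables: for a clause $C$ of the form $\mathtt{H \,\text{:-}\, c, L, B, R}$, with $\mathtt{c}$ a constraint, $\mathtt{L},\mathtt{R}$ (possibly empty) conjunctions of atoms and $\mathtt{B}$ an atom, the linking variables of $\mathtt{B}$ in $C$ are $\mathit{linkvars}(\mathtt{B},C)=\mathit{vars}(\mathtt{B})\cap \mathit{vars}(\{\mathtt{H},\mathtt{c},\mathtt{L},\mathtt{R}\})$; the others variables of $\mathtt{B}$ are non-linking. The NLR (Non-Linking variable Removal) strategy is a goal-directed application of the unfold/fold transformation rules (unfolding, definition introduction, folding) starting from the predicate $\mathtt{unsafe}$. It maintains a set $\mathit{Defs}$ of definition clauses, each of the form $\mathtt{newp(V) \,\text{:-}\,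 B}$ with $\mathtt{newp}$ a fresh predicate symbol and $\mathtt{B}$ an atom of $\mathit{Prog}$. Every definition clause in $\mathit{Defs}$ is unfolded with respect to the leftmost atom in its body (replacing that atom by the bodies of the matching clauses of $\mathit{Prog}$), producing a set $S$ of clauses; every clause in $S$ (and, initially, the clauses for $\mathtt{unsafe}$) is then folded with respect to all atoms in its body, using definitions in $\mathit{Defs}$ or new ones. When a clause $C=\mathtt{H \,\text{:-}\, c, L, B, R}$, where the predicate of $\mathtt{B}$ occurs in $\mathit{Prog}$, cannot be folded w.r.t. $\mathtt{B}$ using $\mathit{Defs}$, a new definition is introduced as follows: let $F$ be $\mathtt{newp(V)\,\text{:-}\,B}$ with $\mathtt{newp}$ fresh and $\mathtt{V}=\mathit{linkvars}(\mathtt{B},C)$. If $\mathit{Defs}$ contains a clause $D$ of the form $\mathtt{newq(Q) \,\text{:-}\, S}$ with $\mathtt{B}\vartheta=\mathtt{S}$ for some renaming substitution $\vartheta$, then $D$ is replaced in $\mathit{Defs}$ by $\mathtt{newp(L)\,\text{:-}\,B}$ where $\mathtt{L}=\mathtt{V}\vartheta\cup\mathtt{Q}$ (merging definitions with the same body atom up to renaming, taking the union of head variables); otherwise $F$ is added to $\mathit{Defs}$. The strategy stops when all clauses in $\mathit{Defs}$ have been unfolded and no new definition is needed for folding; the output $\mathit{Prog}'$ is the set of folded clauses so obtained.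
   Formalization: When definitions are merged, the new clause is newp(L) :- S with S = Bϑ, not newp(L) :- B (which can make NLR diverge); folding uses the final Defs, and unfolding keeps argument equations that involve non-variable terms as constraints. *)

theory Defs
  imports Main
begin

section \<open>Constraints: linear integer arithmetic with integer arrays\<close>

datatype iterm =
    Num int
  | IVar nat
  | Add iterm iterm
  | Scale int iterm
  | Read aterm iterm
and aterm =
    AVar nat
  | Write aterm iterm iterm

datatype trm = IT iterm | AT aterm

datatype var = IV nat | AV nat

datatype acon =
    IEq iterm iterm
  | ILe iterm iterm
  | ILt iterm iterm
  | AEq aterm aterm

type_synonym constr = "acon list"

type_synonym valuation = "(nat \<Rightarrow> int) \<times> (nat \<Rightarrow> int \<Rightarrow> int)"

datatype val = VI int | VA "int \<Rightarrow> int"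

primrec ieval :: "valuation \<Rightarrow> iterm \<Rightarrow> int"
  and aeval :: "valuation \<Rightarrow> aterm \<Rightarrow> int \<Rightarrow> int" where
  "ieval v (Num k) = k"
| "ieval v (IVar n) = fst v n"
| "ieval v (Add s t) = ieval v s + ieval v t"
| "ieval v (Scale k t) = k * ieval v t"
| "ieval v (Read a t) = (aeval v a) (ieval v t)"
| "aeval v (AVar n) = snd v n"
| "aeval v (Write a s t) = (aeval v a) (ieval v s := ieval v t)"

primrec teval :: "valuation \<Rightarrow> trm \<Rightarrow> val" where
  "teval v (IT t) = VI (ieval v t)"
| "teval v (AT a) = VA (aeval v a)"

primrec holds_acon :: "valuation \<Rightarrow> acon \<Rightarrow> bool" where
  "holds_acon v (IEq s t) \<longleftrightarrow> ieval v s = ieval v t"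
| "holds_acon v (ILe s t) \<longleftrightarrow> ieval v s \<le> ieval v t"
| "holds_acon v (ILt s t) \<longleftrightarrow> ieval v s < ieval v t"
| "holds_acon v (AEq a b) \<longleftrightarrow> aeval v a = aeval v b"

definition holds :: "valuation \<Rightarrow> constr \<Rightarrow> bool" where
  "holds v c \<longleftrightarrow> (\<forall>a\<in>set c. holds_acon v a)"


section \<open>CLP programs and their least models\<close>

datatype atom = Atom (pname: string) (args: "trm list")

datatype clause = Clause (head: atom) (con: constr) (body: "atom list")

definition clp_program :: "clause set \<Rightarrow> bool" where
  "clp_program P \<longleftrightarrow> finite P"

datatype sort = IntS | ArrS

primrec sort_of :: "trm \<Rightarrow> sort" where
  "sort_of (IT t) = IntS"
| "sort_of (AT a) = ArrS"

text \<open>A predicate symbol is a name together with the sorts of its arguments, so that the same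
  name used with different arities (or argument sorts) denotes different predicates.\<close>

definition pred_of :: "atom \<Rightarrow> string \<times> sort list" where
  "pred_of A = (pname A, map sort_of (args A))"

definition preds :: "clause set \<Rightarrow> (string \<times> sort list) set" where
  "preds P = (\<Union>C\<in>P. insert (pred_of (head C)) (pred_of ` set (body C)))"

type_synonym gatom = "string \<times> val list"

definition ground :: "valuation \<Rightarrow> atom \<Rightarrow> gatom" where
  "ground v A = (pname A, map (teval v) (args A))"

definition is_model :: "gatom set \<Rightarrow> clause set \<Rightarrow> bool" where
  "is_model I P \<longleftrightarrow> (\<forall>C\<in>P. \<forall>v. holds v (con C) \<and> (\<forall>B\<in>set (body C). ground v B \<in> I)
     \<longrightarrow> ground v (head C) \<in> I)"

definition least_model :: "clause set \<Rightarrow> gatom set" where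
  "least_model P = \<Inter>{I. is_model I P}"

abbreviation unsafe :: string where
  "unsafe \<equiv> ''unsafe''"


section \<open>Variables and substitutions\<close>

primrec ivars :: "iterm \<Rightarrow> var set" and avars :: "aterm \<Rightarrow> var set" where
  "ivars (Num k) = {}"
| "ivars (IVar n) = {IV n}"
| "ivars (Add s t) = ivars s \<union> ivars t"
| "ivars (Scale k t) = ivars t"
| "ivars (Read a t) = avars a \<union> ivars t"
| "avars (AVar n) = {AV n}"
| "avars (Write a s t) = avars a \<union> ivars s \<union> ivars t"

primrec tvars :: "trm \<Rightarrow> var set" where
  "tvars (IT t) = ivars t"
| "tvars (AT a) = avars a"

primrec acon_vars :: "acon \<Rightarrow> var set" where
  "acon_vars (IEq s t) = ivars s \<union> ivars t"
| "acon_vars (ILe s t) = ivars s \<union> ivars t"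
| "acon_vars (ILt s t) = ivars s \<union> ivars t"
| "acon_vars (AEq a b) = avars a \<union> avars b"

definition con_vars :: "constr \<Rightarrow> var set" where
  "con_vars c = (\<Union>a\<in>set c. acon_vars a)"

definition atom_vars :: "atom \<Rightarrow> var set" where
  "atom_vars A = (\<Union>t\<in>set (args A). tvars t)"

definition atoms_vars :: "atom list \<Rightarrow> var set" where
  "atoms_vars Bs = (\<Union>B\<in>set Bs. atom_vars B)"

definition clause_vars :: "clause \<Rightarrow> var set" where
  "clause_vars C = atom_vars (head C) \<union> con_vars (con C) \<union> atoms_vars (body C)"

primrec var_trm :: "var \<Rightarrow> trm" where
  "var_trm (IV n) = IT (IVar n)"
| "var_trm (AV n) = AT (AVar n)"

definition is_var :: "trm \<Rightarrow> bool" where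
  "is_var t \<longleftrightarrow> t \<in> range var_trm"

type_synonym subst = "(nat \<Rightarrow> iterm) \<times> (nat \<Rightarrow> aterm)"

primrec isub :: "subst \<Rightarrow> iterm \<Rightarrow> iterm" and asub :: "subst \<Rightarrow> aterm \<Rightarrow> aterm" where
  "isub \<theta> (Num k) = Num k"
| "isub \<theta> (IVar n) = fst \<theta> n"
| "isub \<theta> (Add s t) = Add (isub \<theta> s) (isub \<theta> t)"
| "isub \<theta> (Scale k t) = Scale k (isub \<theta> t)"
| "isub \<theta> (Read a t) = Read (asub \<theta> a) (isub \<theta> t)"
| "asub \<theta> (AVar n) = snd \<theta> n"
| "asub \<theta> (Write a s t) = Write (asub \<theta> a) (isub \<theta> s) (isub \<theta> t)"

primrec tsub :: "subst \<Rightarrow> trm \<Rightarrow> trm" where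
  "tsub \<theta> (IT t) = IT (isub \<theta> t)"
| "tsub \<theta> (AT a) = AT (asub \<theta> a)"

primrec acon_sub :: "subst \<Rightarrow> acon \<Rightarrow> acon" where
  "acon_sub \<theta> (IEq s t) = IEq (isub \<theta> s) (isub \<theta> t)"
| "acon_sub \<theta> (ILe s t) = ILe (isub \<theta> s) (isub \<theta> t)"
| "acon_sub \<theta> (ILt s t) = ILt (isub \<theta> s) (isub \<theta> t)"
| "acon_sub \<theta> (AEq a b) = AEq (asub \<theta> a) (asub \<theta> b)"

definition atom_sub :: "subst \<Rightarrow> atom \<Rightarrow> atom" where
  "atom_sub \<theta> A = Atom (pname A) (map (tsub \<theta>) (args A))"

definition clause_sub :: "subst \<Rightarrow> clause \<Rightarrow> clause" where
  "clause_sub \<theta> C =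
     Clause (atom_sub \<theta> (head C)) (map (acon_sub \<theta>) (con C)) (map (atom_sub \<theta>) (body C))"

definition is_renaming :: "subst \<Rightarrow> bool" where
  "is_renaming \<theta> \<longleftrightarrow>
     (\<exists>f g. bij f \<and> bij g \<and> \<theta> = ((\<lambda>n. IVar (f n)), (\<lambda>n. AVar (g n))))"

definition unifies :: "subst \<Rightarrow> (trm \<times> trm) set \<Rightarrow> bool" where
  "unifies \<theta> E \<longleftrightarrow> (\<forall>(s, t)\<in>E. tsub \<theta> s = tsub \<theta> t)"

definition is_mgu :: "subst \<Rightarrow> (trm \<times> trm) set \<Rightarrow> bool" where
  "is_mgu \<theta> E \<longleftrightarrow> unifies \<theta> E \<and>
     (\<forall>\<tau>. unifies \<tau> E \<longrightarrow>
        (\<exists>\<rho>. \<forall>x. tsub \<tau> (var_trm x) = tsub \<rho> (tsub \<theta> (var_trm x))))"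


section \<open>Linking variables\<close>

text \<open>Atoms in a body are referred to by position: for \<open>C = H :- c, L, B, R\<close> with
  \<open>B = body C ! i\<close>, \<open>rest_vars C i\<close> is \<open>vars({H, c, L, R})\<close>.\<close>

definition rest_vars :: "clause \<Rightarrow> nat \<Rightarrow> var set" where
  "rest_vars C i = atom_vars (head C) \<union> con_vars (con C)
     \<union> atoms_vars (take i (body C)) \<union> atoms_vars (drop (Suc i) (body C))"

definition linkvars :: "clause \<Rightarrow> nat \<Rightarrow> var set" where
  "linkvars C i = atom_vars (body C ! i) \<inter> rest_vars C i"


section \<open>Unfolding\<close>

fun eq_con :: "trm \<Rightarrow> trm \<Rightarrow> acon" where
  "eq_con (IT s) (IT t) = IEq s t"
| "eq_con (AT a) (AT b) = AEq a b"
| "eq_con _ _ = ILt (Num 0) (Num 0)"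

text \<open>Resolving \<open>C = H :- c, p(t\<^sub>1,\<dots>,t\<^sub>n), R\<close> with a clause \<open>p(s\<^sub>1,\<dots>,s\<^sub>n) :- d, Bs\<close> (renamed apart).
  The equations \<open>t\<^sub>i = s\<^sub>i\<close> between two variables are solved by a most general unifier. As \<open>+\<close>, \<open>*\<close>, read
  and write are interpreted, the other equations are kept as constraints: solving them by
  syntactic unification would lose solutions. If all arguments of atoms are variables, this is
  ordinary resolution with an mgu. The last case of \<open>eq_con\<close> does not arise, because both atoms
  have the same predicate.\<close>

definition resolvent :: "clause \<Rightarrow> clause \<Rightarrow> clause \<Rightarrow> bool" where
  "resolvent C K E \<longleftrightarrow>
     (\<exists>B R \<rho> K' eqs \<sigma>.
        body C = B # R \<and> pred_of B = pred_of (head K) \<and>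
        is_renaming \<rho> \<and> K' = clause_sub \<rho> K \<and> clause_vars C \<inter> clause_vars K' = {} \<and>
        eqs = zip (args B) (args (head K')) \<and>
        is_mgu \<sigma> {(t, s) \<in> set eqs. is_var t \<and> is_var s} \<and>
        E = clause_sub \<sigma>
              (Clause (head C)
                 (con C @ map (\<lambda>(t, s). eq_con t s)
                            (filter (\<lambda>(t, s). \<not> (is_var t \<and> is_var s)) eqs) @ con K')
                 (body K' @ R)))"

text \<open>\<open>U\<close> is a result of unfolding \<open>C\<close> with respect to its leftmost body atom; it is determined up to
  renaming of variables.\<close>

definition unfold_result :: "clause set \<Rightarrow> clause \<Rightarrow> clause set \<Rightarrow> bool" where
  "unfold_result P C U \<longleftrightarrow>
     (\<exists>g. U = g ` {K \<in> P. pred_of (head K) = pred_of (hd (body C))} \<and>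
          (\<forall>K\<in>P. pred_of (head K) = pred_of (hd (body C)) \<longrightarrow> resolvent C K (g K)))"


section \<open>Definitions and folding\<close>

definition def_clause :: "string \<Rightarrow> var list \<Rightarrow> atom \<Rightarrow> clause" where
  "def_clause newp V B = Clause (Atom newp (map var_trm V)) [] [B]"

text \<open>\<open>C\<close> can be folded with respect to its \<open>i\<close>-th body atom using \<open>newp(V) :- T\<close> and \<open>\<theta>\<close>; that
  atom is then replaced by \<open>newp(V)\<theta>\<close>. The last conjunct is the usual condition on the variables
  of \<open>T\<close> that do not occur in the head.\<close>

definition fold_ok :: "clause \<Rightarrow> nat \<Rightarrow> var list \<Rightarrow> atom \<Rightarrow> subst \<Rightarrow> bool" where
  "fold_ok C i V T \<theta> \<longleftrightarrow>
     body C ! i = atom_sub \<theta> T \<and>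
     (\<forall>x\<in>atom_vars T - set V. \<exists>y.
        tsub \<theta> (var_trm x) = var_trm y \<and> y \<notin> rest_vars C i \<and>
        (\<forall>z\<in>(atom_vars T \<union> set V) - {x}. y \<notin> tvars (tsub \<theta> (var_trm z))))"

definition foldable :: "clause set \<Rightarrow> clause \<Rightarrow> nat \<Rightarrow> bool" where
  "foldable Defs C i \<longleftrightarrow>
     (\<exists>newp V T \<theta>. def_clause newp V T \<in> Defs \<and> fold_ok C i V T \<theta>)"

definition folded_all :: "clause set \<Rightarrow> clause \<Rightarrow> clause \<Rightarrow> bool" where
  "folded_all Defs C C' \<longleftrightarrow>
     head C' = head C \<and> con C' = con C \<and> length (body C') = length (body C) \<and>
     (\<forall>i<length (body C). \<exists>newp V T \<theta>.
        def_clause newp V T \<in> Defs \<and> fold_ok C i V T \<theta> \<and>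
        body C' ! i = atom_sub \<theta> (Atom newp (map var_trm V)))"


section \<open>The NLR strategy\<close>

text \<open>A state \<open>(Defs, Unf, S, N)\<close> consists of the current definitions, the definitions
  unfolded so far, the clauses to be folded, and the predicate names used so far. All choices the
  strategy leaves open (order of the steps, fresh names, order of arguments, renamings) are
  nondeterministic.\<close>

type_synonym nlr_state = "clause set \<times> clause set \<times> clause set \<times> string set"

definition nlr_init :: "clause set \<Rightarrow> nlr_state" where
  "nlr_init P =
     ({}, {}, {C \<in> P. head C = Atom unsafe []}, insert unsafe (fst ` preds P))"

inductive nlr_step :: "clause set \<Rightarrow> nlr_state \<Rightarrow> nlr_state \<Rightarrow> bool" for P where
  unfold:
    "\<lbrakk> D \<in> Defs; D \<notin> Unf; unfold_result P D U \<rbrakk>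
     \<Longrightarrow> nlr_step P (Defs, Unf, S, N) (Defs, insert D Unf, S \<union> U, N)"
| add_def:
    "\<lbrakk> C \<in> S; i < length (body C); B = body C ! i; pred_of B \<in> preds P;
       \<not> foldable Defs C i; newp \<notin> N; distinct V; set V = linkvars C i;
       \<nexists>newq Q T \<theta>. def_clause newq Q T \<in> Defs \<and> is_renaming \<theta> \<and> atom_sub \<theta> B = T \<rbrakk>
     \<Longrightarrow> nlr_step P (Defs, Unf, S, N)
           (insert (def_clause newp V B) Defs, Unf, S, insert newp N)"
| merge_def:
    "\<lbrakk> C \<in> S; i < length (body C); B = body C ! i; pred_of B \<in> preds P;
       \<not> foldable Defs C i; newp \<notin> N;
       def_clause newq Q T \<in> Defs; is_renaming \<theta>; atom_sub \<theta> B = T;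
       distinct L; set L = (\<Union>x\<in>linkvars C i. tvars (tsub \<theta> (var_trm x))) \<union> set Q \<rbrakk>
     \<Longrightarrow> nlr_step P (Defs, Unf, S, N)
           (insert (def_clause newp L T) (Defs - {def_clause newq Q T}), Unf, S, insert newp N)"

text \<open>Folding is performed with the final definitions, since a definition used earlier could be
  replaced later on.\<close>

definition nlr_result :: "nlr_state \<Rightarrow> clause set \<Rightarrow> bool" where
  "nlr_result s P' \<longleftrightarrow>
     (case s of (Defs, Unf, S, N) \<Rightarrow>
        Defs \<subseteq> Unf \<and> (\<exists>f. P' = f ` S \<and> (\<forall>C\<in>S. folded_all Defs C (f C))))"

definition nlr_output :: "clause set \<Rightarrow> clause set \<Rightarrow> bool" where
  "nlr_output P P' \<longleftrightarrow> (\<exists>s. (nlr_step P)\<^sup>*\<^sup>* (nlr_init P) s \<and> nlr_result s P')"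

text \<open>Every run is finite, and a run that cannot be continued has reached a state in which all
  definitions are unfolded and all clauses can be folded.\<close>

definition nlr_terminates :: "clause set \<Rightarrow> bool" where
  "nlr_terminates P \<longleftrightarrow>
     \<not> (\<exists>r. r 0 = nlr_init P \<and> (\<forall>n. nlr_step P (r n) (r (Suc n)))) \<and>
     (\<forall>s. (nlr_step P)\<^sup>*\<^sup>* (nlr_init P) s \<and> (\<nexists>s'. nlr_step P s s') \<longrightarrow> (\<exists>P'. nlr_result s P'))"

end

theory Submission
  imports Defs
begin

text \<open>Unfolding only solves equations between variables, so every body atom met by the strategy is a
  variable-to-variable instance of a body atom of the program. Up to renaming there are finitely many
  of these, \<open>Defs\<close> holds at most one definition for each, and a merge strictly enlarges the set of
  head variables, since otherwise the clause could have been folded already. Hence only finitely many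
  definitions are introduced, and each is unfolded once.

  For correctness, a definition \<open>newp(V) :- T\<close> is read as \<open>newp(V) \<longleftrightarrow> \<exists>Y. T\<close>, where \<open>Y\<close>
  are the variables of \<open>T\<close> not in \<open>V\<close>. Under this reading the least model of the program yields a model of the output and, conversely, the
  least model of the output yields a model of the program. The folding condition is what allows the
  variables hidden by the folded atoms to be reassigned independently of each other.\<close>

section \<open>Substitutions and valuations\<close>

definition vsub :: "valuation \<Rightarrow> subst \<Rightarrow> valuation" where
  "vsub v \<theta> = ((\<lambda>n. ieval v (fst \<theta> n)), (\<lambda>n. aeval v (snd \<theta> n)))"

lemma eval_sub:
  "ieval v (isub \<theta> t) = ieval (vsub v \<theta>) t"
  "aeval v (asub \<theta> a) = aeval (vsub v \<theta>) a"
  by (induction t and a) (auto simp: vsub_def)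

lemma teval_sub: "teval v (tsub \<theta> t) = teval (vsub v \<theta>) t"
  by (cases t) (auto simp: eval_sub)

lemma ground_sub: "ground v (atom_sub \<theta> A) = ground (vsub v \<theta>) A"
  by (simp add: ground_def atom_sub_def teval_sub)

lemma holds_acon_sub: "holds_acon v (acon_sub \<theta> c) = holds_acon (vsub v \<theta>) c"
  by (cases c) (auto simp: eval_sub)

lemma holds_sub: "holds v (map (acon_sub \<theta>) c) = holds (vsub v \<theta>) c"
  by (simp add: holds_def holds_acon_sub)

definition agree :: "var set \<Rightarrow> valuation \<Rightarrow> valuation \<Rightarrow> bool" where
  "agree X v w \<longleftrightarrow> (\<forall>x\<in>X. teval v (var_trm x) = teval w (var_trm x))"

lemma agree_mono: "agree X v w \<Longrightarrow> Y \<subseteq> X \<Longrightarrow> agree Y v w"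
  by (auto simp: agree_def)

lemma eval_agree:
  "agree (ivars t) v w \<Longrightarrow> ieval v t = ieval w t"
  "agree (avars a) v w \<Longrightarrow> aeval v a = aeval w a"
  by (induction t and a) (auto simp: agree_def)

lemma teval_agree: "agree (tvars t) v w \<Longrightarrow> teval v t = teval w t"
  by (cases t) (auto dest: eval_agree)

lemma ground_agree: "agree (atom_vars A) v w \<Longrightarrow> ground v A = ground w A"
  by (auto simp: ground_def atom_vars_def agree_def intro!: teval_agree)

lemma holds_acon_agree: "agree (acon_vars c) v w \<Longrightarrow> holds_acon v c = holds_acon w c"
proof (cases c)
  case (IEq s t)
  moreover assume "agree (acon_vars c) v w"
  ultimately show ?thesis using eval_agree(1)[of s v w] eval_agree(1)[of t v w]
    by (simp add: agree_def)
next
  case (ILe s t)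
  moreover assume "agree (acon_vars c) v w"
  ultimately show ?thesis using eval_agree(1)[of s v w] eval_agree(1)[of t v w]
    by (simp add: agree_def)
next
  case (ILt s t)
  moreover assume "agree (acon_vars c) v w"
  ultimately show ?thesis using eval_agree(1)[of s v w] eval_agree(1)[of t v w]
    by (simp add: agree_def)
next
  case (AEq s t)
  moreover assume "agree (acon_vars c) v w"
  ultimately show ?thesis using eval_agree(2)[of s v w] eval_agree(2)[of t v w]
    by (simp add: agree_def)
qed

lemma holds_agree: "agree (con_vars c) v w \<Longrightarrow> holds v c = holds w c"
  unfolding holds_def con_vars_def
  by (intro ball_cong refl holds_acon_agree) (auto elim: agree_mono)

definition mkval :: "(var \<Rightarrow> val) \<Rightarrow> valuation" where
  "mkval h = ((\<lambda>n. case h (IV n) of VI k \<Rightarrow> k | VA a \<Rightarrow> 0),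
              (\<lambda>n. case h (AV n) of VI k \<Rightarrow> (\<lambda>_. 0) | VA a \<Rightarrow> a))"

lemma teval_mkval:
  assumes "h x = teval u t" and "sort_of t = sort_of (var_trm x)"
  shows "teval (mkval h) (var_trm x) = h x"
  using assms by (cases x; cases t) (auto simp: mkval_def)

lemma sort_of_tsub [simp]: "sort_of (tsub \<theta> t) = sort_of t"
  by (cases t) auto

lemma tvars_var_trm [simp]: "tvars (var_trm x) = {x}"
  by (cases x) auto

lemma var_trm_eq_iff [simp]: "var_trm x = var_trm y \<longleftrightarrow> x = y"
  by (cases x; cases y) auto

lemma is_var_var_trm [simp]: "is_var (var_trm x)"
  by (simp add: is_var_def)

lemma vars_sub:
  "ivars (isub \<theta> t) = (\<Union>x\<in>ivars t. tvars (tsub \<theta> (var_trm x)))"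
  "avars (asub \<theta> a) = (\<Union>x\<in>avars a. tvars (tsub \<theta> (var_trm x)))"
  by (induction t and a) auto

lemma tvars_sub: "tvars (tsub \<theta> t) = (\<Union>x\<in>tvars t. tvars (tsub \<theta> (var_trm x)))"
  by (cases t) (auto simp: vars_sub)

lemma atom_vars_sub: "atom_vars (atom_sub \<theta> A) = (\<Union>x\<in>atom_vars A. tvars (tsub \<theta> (var_trm x)))"
proof -
  have "atom_vars (atom_sub \<theta> A) = (\<Union>t\<in>set (args A). tvars (tsub \<theta> t))"
    by (simp add: atom_vars_def atom_sub_def)
  also have "\<dots> = (\<Union>t\<in>set (args A). \<Union>x\<in>tvars t. tvars (tsub \<theta> (var_trm x)))"
    by (intro SUP_cong refl tvars_sub)
  finally show ?thesis by (simp add: atom_vars_def)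
qed

lemma sub_cong:
  "(\<And>x. x \<in> ivars t \<Longrightarrow> tsub \<theta> (var_trm x) = tsub \<theta>' (var_trm x)) \<Longrightarrow> isub \<theta> t = isub \<theta>' t"
  "(\<And>x. x \<in> avars a \<Longrightarrow> tsub \<theta> (var_trm x) = tsub \<theta>' (var_trm x)) \<Longrightarrow> asub \<theta> a = asub \<theta>' a"
  by (induction t and a) auto

lemma tsub_cong:
  "(\<And>x. x \<in> tvars t \<Longrightarrow> tsub \<theta> (var_trm x) = tsub \<theta>' (var_trm x)) \<Longrightarrow> tsub \<theta> t = tsub \<theta>' t"
  by (cases t) (auto intro!: sub_cong)

lemma atom_sub_cong:
  assumes "\<And>x. x \<in> atom_vars A \<Longrightarrow> tsub \<theta> (var_trm x) = tsub \<theta>' (var_trm x)"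
  shows "atom_sub \<theta> A = atom_sub \<theta>' A"
proof -
  have "tsub \<theta> t = tsub \<theta>' t" if "t \<in> set (args A)" for t
    by (rule tsub_cong, rule assms) (use that in \<open>auto simp: atom_vars_def\<close>)
  then show ?thesis by (simp add: atom_sub_def)
qed

lemma pred_of_sub [simp]: "pred_of (atom_sub \<theta> A) = pred_of A"
  by (simp add: pred_of_def atom_sub_def)

lemma finite_ivars [simp]: "finite (ivars t)" and finite_avars [simp]: "finite (avars a)"
  by (induction t and a) auto

lemma finite_tvars [simp]: "finite (tvars t)"
  by (cases t) auto

lemma finite_atom_vars [simp]: "finite (atom_vars A)"
  by (simp add: atom_vars_def)

lemma finite_clause_vars [simp]: "finite (clause_vars C)"
proof -
  have "finite (acon_vars c)" for c by (cases c) auto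
  then show ?thesis by (simp add: clause_vars_def con_vars_def atoms_vars_def)
qed

lemma finite_linkvars [simp]: "finite (linkvars C i)"
  by (simp add: linkvars_def)

fun val_sort :: "val \<Rightarrow> sort" where
  "val_sort (VI k) = IntS"
| "val_sort (VA a) = ArrS"

lemma val_sort_teval: "val_sort (teval v t) = sort_of t"
  by (cases t) auto

lemma ground_eq_pred_of:
  assumes "ground u A = ground v B"
  shows "pred_of A = pred_of B"
proof -
  have "map val_sort (map (teval u) (args A)) = map val_sort (map (teval v) (args B))"
    using assms by (simp add: ground_def del: map_map)
  then show ?thesis
    using assms by (simp add: ground_def pred_of_def o_def val_sort_teval)
qed


section \<open>Variable-to-variable substitutions\<close>

definition ren :: "(nat \<Rightarrow> nat) \<Rightarrow> (nat \<Rightarrow> nat) \<Rightarrow> subst" where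
  "ren f g = ((\<lambda>n. IVar (f n)), (\<lambda>n. AVar (g n)))"

primrec vren :: "(nat \<Rightarrow> nat) \<Rightarrow> (nat \<Rightarrow> nat) \<Rightarrow> var \<Rightarrow> var" where
  "vren f g (IV n) = IV (f n)"
| "vren f g (AV n) = AV (g n)"

lemma tsub_ren_var [simp]: "tsub (ren f g) (var_trm x) = var_trm (vren f g x)"
  by (cases x) (auto simp: ren_def)

lemma is_renaming_iff: "is_renaming \<theta> \<longleftrightarrow> (\<exists>f g. bij f \<and> bij g \<and> \<theta> = ren f g)"
  by (simp add: is_renaming_def ren_def)

lemma sub_ren_ren:
  "isub (ren f g) (isub (ren f' g') t) = isub (ren (f \<circ> f') (g \<circ> g')) t"
  "asub (ren f g) (asub (ren f' g') a) = asub (ren (f \<circ> f') (g \<circ> g')) a"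
  by (induction t and a) (auto simp: ren_def)

lemma tsub_ren_ren: "tsub (ren f g) (tsub (ren f' g') t) = tsub (ren (f \<circ> f') (g \<circ> g')) t"
  by (cases t) (auto simp: sub_ren_ren)

lemma atom_sub_ren_ren:
  "atom_sub (ren f g) (atom_sub (ren f' g') A) = atom_sub (ren (f \<circ> f') (g \<circ> g')) A"
  by (simp add: atom_sub_def tsub_ren_ren)

lemma sub_ren_id: "isub (ren id id) t = t" "asub (ren id id) a = a"
  by (induction t and a) (auto simp: ren_def)

lemma tsub_ren_id: "tsub (ren id id) t = t"
  by (cases t) (auto simp: sub_ren_id)

lemma atom_sub_ren_id: "atom_sub (ren id id) A = A"
  by (cases A) (simp add: atom_sub_def tsub_ren_id map_idI)

lemma atom_vars_ren: "atom_vars (atom_sub (ren f g) A) = vren f g ` atom_vars A"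
  by (auto simp: atom_vars_sub)

lemma inj_vren: "inj f \<Longrightarrow> inj g \<Longrightarrow> inj (vren f g)"
  by (rule injI) (case_tac x; case_tac y; auto dest: injD)

lemma vren_inv: "surj f \<Longrightarrow> surj g \<Longrightarrow> vren f g (vren (inv f) (inv g) x) = x"
  by (cases x) (auto simp: surj_f_inv_f)

lemma finite_injection_extends:
  fixes h1 h2 :: "'a \<Rightarrow> 'b"
  assumes "finite X" and ker: "\<And>m n. m \<in> X \<Longrightarrow> n \<in> X \<Longrightarrow> h1 m = h1 n \<longleftrightarrow> h2 m = h2 n"
  shows "\<exists>F. bij F \<and> (\<forall>m\<in>X. F (h1 m) = h2 m)"
proof -
  define k where "k = h2 \<circ> inv_into X h1"
  let ?A = "h1 ` X" and ?B = "h2 ` X"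
  have k: "k (h1 m) = h2 m" if "m \<in> X" for m
    using that ker[of "inv_into X h1 (h1 m)" m]
    by (simp add: k_def f_inv_into_f inv_into_into)
  have bk: "bij_betw k ?A ?B"
    unfolding bij_betw_def
  proof
    show "inj_on k ?A"
      by (rule inj_onI) (use k ker in auto)
    show "k ` ?A = ?B"
      using k by (force simp: image_iff)
  qed
  have fin: "finite ?A" "finite ?B" using assms(1) by auto
  have "card ?A = card ?B" using bk by (rule bij_betw_same_card)
  then have "card (?B - ?A) = card (?A - ?B)"
    using fin by (metis Int_commute card_Diff_subset_Int finite_Int)
  then obtain l where l: "bij_betw l (?B - ?A) (?A - ?B)"
    using finite_same_card_bij fin by blast
  define F where "F = (\<lambda>x. if x \<in> ?A then k x else if x \<in> ?B then l x else x)"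
  have "bij_betw F ?A ?B"
    using bk by (rule bij_betw_cong[THEN iffD1, rotated]) (simp add: F_def)
  moreover have "bij_betw F (?B - ?A) (?A - ?B)"
    using l by (rule bij_betw_cong[THEN iffD1, rotated]) (simp add: F_def)
  ultimately have "bij_betw F (?A \<union> (?B - ?A)) (?B \<union> (?A - ?B))"
    by (rule bij_betw_combine) auto
  moreover have "bij_betw F (- (?A \<union> ?B)) (- (?A \<union> ?B))"
    using bij_betw_id by (rule bij_betw_cong[THEN iffD1, rotated]) (auto simp: F_def)
  ultimately have "bij_betw F ((?A \<union> (?B - ?A)) \<union> - (?A \<union> ?B)) ((?B \<union> (?A - ?B)) \<union> - (?A \<union> ?B))"
    by (rule bij_betw_combine) auto
  moreover have "(?A \<union> (?B - ?A)) \<union> - (?A \<union> ?B) = UNIV" "(?B \<union> (?A - ?B)) \<union> - (?A \<union> ?B) = UNIV"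
    by auto
  ultimately have "bij F" by simp
  moreover have "\<forall>m\<in>X. F (h1 m) = h2 m" using k by (simp add: F_def)
  ultimately show ?thesis by blast
qed

definition ker_on :: "var set \<Rightarrow> (var \<Rightarrow> var) \<Rightarrow> (var \<times> var) set" where
  "ker_on X h = {(x, y) \<in> X \<times> X. h x = h y}"

lemma same_kernel_variant:
  assumes "ker_on (atom_vars B) (vren f1 g1) = ker_on (atom_vars B) (vren f2 g2)"
  shows "\<exists>\<theta>. is_renaming \<theta> \<and> atom_sub \<theta> (atom_sub (ren f1 g1) B) = atom_sub (ren f2 g2) B"
proof -
  let ?X = "atom_vars B"
  have ker: "vren f1 g1 x = vren f1 g1 y \<longleftrightarrow> vren f2 g2 x = vren f2 g2 y"
    if "x \<in> ?X" "y \<in> ?X" for x y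
    using assms that by (auto simp: ker_on_def set_eq_iff)
  have "inj IV" "inj AV" by (auto intro: injI)
  then have fin: "finite (IV -` ?X)" "finite (AV -` ?X)"
    by (auto intro: finite_vimageI)
  obtain F where F: "bij F" "\<And>m. IV m \<in> ?X \<Longrightarrow> F (f1 m) = f2 m"
    using finite_injection_extends[OF fin(1), of f1 f2] ker[of "IV _" "IV _"] by auto
  obtain G where G: "bij G" "\<And>m. AV m \<in> ?X \<Longrightarrow> G (g1 m) = g2 m"
    using finite_injection_extends[OF fin(2), of g1 g2] ker[of "AV _" "AV _"] by auto
  have "atom_sub (ren (F \<circ> f1) (G \<circ> g1)) B = atom_sub (ren f2 g2) B"
  proof (rule atom_sub_cong)
    fix x assume "x \<in> ?X"
    then show "tsub (ren (F \<circ> f1) (G \<circ> g1)) (var_trm x) = tsub (ren f2 g2) (var_trm x)"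
      using F G by (cases x) (auto simp: ren_def)
  qed
  then show ?thesis
    using F(1) G(1) by (intro exI[of _ "ren F G"]) (auto simp: is_renaming_iff atom_sub_ren_ren)
qed

lemma renaming_inverse:
  assumes "is_renaming \<theta>"
  shows "\<exists>\<theta>'. is_renaming \<theta>' \<and> (\<forall>A. atom_sub \<theta>' (atom_sub \<theta> A) = A)"
proof -
  obtain f g where fg: "bij f" "bij g" "\<theta> = ren f g"
    using assms by (auto simp: is_renaming_iff)
  show ?thesis
    using fg bij_imp_bij_inv[of f] bij_imp_bij_inv[of g]
    by (intro exI[of _ "ren (inv f) (inv g)"])
      (auto simp: is_renaming_iff atom_sub_ren_ren atom_sub_ren_id bij_is_inj)
qed


section \<open>Unifiers and resolvents\<close>

lemma mgu_exists:
  assumes sorts: "\<And>t s. (t, s) \<in> E \<Longrightarrow> sort_of t = sort_of s \<and> is_var t \<and> is_var s"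
  shows "\<exists>\<sigma>. is_mgu \<sigma> E"
proof -
  define eqv where "eqv x y \<longleftrightarrow> sort_of (var_trm x) = sort_of (var_trm y) \<and>
    (\<forall>\<tau>. unifies \<tau> E \<longrightarrow> tsub \<tau> (var_trm x) = tsub \<tau> (var_trm y))" for x y
  define rep where "rep x = (SOME y. eqv x y)" for x
  have rep: "eqv x (rep x)" for x
    unfolding rep_def by (rule someI[of _ x]) (simp add: eqv_def)
  have rep_eq: "rep x = rep y" if "eqv x y" for x y
  proof -
    have "eqv x z \<longleftrightarrow> eqv y z" for z using that by (auto simp: eqv_def)
    then show ?thesis by (simp add: rep_def)
  qed
  define \<sigma> :: subst where
    "\<sigma> = ((\<lambda>n. case rep (IV n) of IV m \<Rightarrow> IVar m | AV m \<Rightarrow> IVar 0),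
          (\<lambda>n. case rep (AV n) of IV m \<Rightarrow> AVar 0 | AV m \<Rightarrow> AVar m))"
  have \<sigma>: "tsub \<sigma> (var_trm x) = var_trm (rep x)" for x
    using rep[of x] by (cases x) (auto simp: \<sigma>_def eqv_def split: var.split)
  have "tsub \<sigma> t = tsub \<sigma> s" if ts: "(t, s) \<in> E" for t s
  proof -
    obtain x y where xy: "t = var_trm x" "s = var_trm y"
      using sorts[OF ts] by (auto simp: is_var_def)
    have "eqv x y" using sorts[OF ts] ts unfolding eqv_def xy unifies_def by auto
    then show ?thesis by (simp add: xy \<sigma> rep_eq)
  qed
  moreover have "\<forall>x. tsub \<tau> (var_trm x) = tsub \<tau> (tsub \<sigma> (var_trm x))" if "unifies \<tau> E" for \<tau>
    using rep that unfolding \<sigma> eqv_def by blast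
  ultimately have "is_mgu \<sigma> E"
    unfolding is_mgu_def by (auto simp: unifies_def)
  then show ?thesis by blast
qed

lemma tsub_is_var: "is_var (tsub \<rho> t) \<Longrightarrow> is_var t"
proof (cases t)
  case (IT s)
  assume "is_var (tsub \<rho> t)"
  then obtain x where "tsub \<rho> t = var_trm x" by (auto simp: is_var_def)
  with IT show ?thesis
    by (cases s; cases x) (auto simp: is_var_def intro: range_eqI[of _ _ "IV _"])
next
  case (AT s)
  assume "is_var (tsub \<rho> t)"
  then obtain x where "tsub \<rho> t = var_trm x" by (auto simp: is_var_def)
  with AT show ?thesis
    by (cases s; cases x) (auto simp: is_var_def intro: range_eqI[of _ _ "AV _"])
qed

lemma mgu_of_vars_is_ren:
  assumes mgu: "is_mgu \<sigma> E"
    and sorts: "\<And>t s. (t, s) \<in> E \<Longrightarrow> sort_of t = sort_of s \<and> is_var t \<and> is_var s"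
  shows "\<exists>f g. \<sigma> = ren f g"
proof -
  \<comment> \<open>Collapsing all variables of each sort unifies \<open>E\<close>, hence factors through \<open>\<sigma>\<close>.\<close>
  let ?\<tau> = "ren (\<lambda>_. 0) (\<lambda>_. 0)"
  have "tsub ?\<tau> t = tsub ?\<tau> s" if ts: "(t, s) \<in> E" for t s
  proof -
    obtain x y where "t = var_trm x" "s = var_trm y"
      using sorts[OF ts] by (auto simp: is_var_def)
    then show ?thesis using sorts[OF ts] by (cases x; cases y) (auto simp: ren_def)
  qed
  then have "unifies ?\<tau> E" by (auto simp: unifies_def)
  then obtain \<rho> where \<rho>: "tsub ?\<tau> (var_trm x) = tsub \<rho> (tsub \<sigma> (var_trm x))" for x
    using mgu unfolding is_mgu_def by blast
  have var: "is_var (tsub \<sigma> (var_trm x))" for x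
    using tsub_is_var[of \<rho>] by (simp flip: \<rho>)
  have "\<exists>m. fst \<sigma> n = IVar m" for n
    using var[of "IV n"] by (auto simp: is_var_def) (case_tac x; auto)
  moreover have "\<exists>m. snd \<sigma> n = AVar m" for n
    using var[of "AV n"] by (auto simp: is_var_def) (case_tac x; auto)
  ultimately obtain f g where "\<And>n. fst \<sigma> n = IVar (f n)" "\<And>n. snd \<sigma> n = AVar (g n)" by metis
  then have "\<sigma> = ren f g" by (cases \<sigma>) (auto simp: ren_def)
  then show ?thesis by blast
qed

text \<open>A semantic solution \<open>w\<close> of \<open>E\<close> induces a syntactic unifier: send each variable to a chosen
  variable of the same sort and value. Being an instance of \<open>\<sigma>\<close>, it shows that \<open>w\<close> factors
  through \<open>\<sigma>\<close>.\<close>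

lemma solution_factors_mgu:
  assumes mgu: "is_mgu \<sigma> E"
    and vars: "\<And>t s. (t, s) \<in> E \<Longrightarrow> is_var t \<and> is_var s"
    and sol: "\<And>t s. (t, s) \<in> E \<Longrightarrow> teval w t = teval w s"
  shows "\<exists>w'. vsub w' \<sigma> = w"
proof -
  define f where "f n = (SOME m. fst w m = fst w n)" for n
  define g where "g n = (SOME m. snd w m = snd w n)" for n
  have f: "fst w (f n) = fst w n" for n unfolding f_def by (rule someI) simp
  have g: "snd w (g n) = snd w n" for n unfolding g_def by (rule someI) simp
  have f_eq: "f m = f n" if "fst w m = fst w n" for m n using that by (simp add: f_def)
  have g_eq: "g m = g n" if "snd w m = snd w n" for m n using that by (simp add: g_def)
  have "tsub (ren f g) t = tsub (ren f g) s" if ts: "(t, s) \<in> E" for t s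
  proof -
    obtain x y where "t = var_trm x" "s = var_trm y"
      using vars[OF ts] by (auto simp: is_var_def)
    then show ?thesis using sol[OF ts] by (cases x; cases y) (auto simp: ren_def intro: f_eq g_eq)
  qed
  then have "unifies (ren f g) E" by (auto simp: unifies_def)
  then obtain \<rho> where \<rho>: "tsub (ren f g) (var_trm x) = tsub \<rho> (tsub \<sigma> (var_trm x))" for x
    using mgu unfolding is_mgu_def by blast
  have eq: "teval (vsub (vsub w \<rho>) \<sigma>) (var_trm x) = teval w (var_trm x)" for x
    unfolding teval_sub[symmetric] \<rho>[symmetric]
    by (cases x) (auto simp: ren_def f g)
  have "fst (vsub (vsub w \<rho>) \<sigma>) n = fst w n" "snd (vsub (vsub w \<rho>) \<sigma>) n = snd w n" for n
    using eq[of "IV n"] eq[of "AV n"] by simp_all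
  then have "vsub (vsub w \<rho>) \<sigma> = w"
    by (intro prod_eqI ext) auto
  then show ?thesis by blast
qed

lemma fresh_renaming_exists:
  assumes "finite X" "finite Y"
  shows "\<exists>f. bij f \<and> X \<inter> vren f f ` Y = {}"
proof -
  define idx where "idx x = (case x of IV n \<Rightarrow> n | AV n \<Rightarrow> n)" for x
  have "finite (idx ` (X \<union> Y))" using assms by simp
  then obtain N where N: "\<forall>n\<in>idx ` (X \<union> Y). n < N"
    using finite_nat_set_iff_bounded by blast
  define f where "f n = (if n < N then n + N else if n < 2 * N then n - N else n)" for n
  have "f (f n) = n" for n by (auto simp: f_def)
  then have "bij f" by (intro o_bij[of f f]) auto
  moreover have "X \<inter> vren f f ` Y = {}"
  proof (rule ccontr)
    assume "X \<inter> vren f f ` Y \<noteq> {}"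
    then obtain y where y: "y \<in> Y" "vren f f y \<in> X" by auto
    then have "idx y < N" "idx (vren f f y) < N" using N by auto
    then show False by (cases y) (auto simp: idx_def f_def)
  qed
  ultimately show ?thesis by blast
qed

lemma acon_vars_ren: "acon_vars (acon_sub (ren f g) c) = vren f g ` acon_vars c"
  by (cases c) (auto simp: vars_sub)

lemma clause_vars_ren: "clause_vars (clause_sub (ren f g) K) = vren f g ` clause_vars K"
  by (auto simp: clause_vars_def clause_sub_def con_vars_def atoms_vars_def atom_vars_ren
      acon_vars_ren image_Un image_UN)

lemma zip_same_sorts:
  assumes "pred_of A = pred_of B" "(t, s) \<in> set (zip (args A) (args B))"
  shows "sort_of t = sort_of s"
proof -
  have *: "map sort_of (args A) = map sort_of (args B)" using assms(1) by (simp add: pred_of_def)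
  obtain i where i: "i < length (args A)" "i < length (args B)" "t = args A ! i" "s = args B ! i"
    using assms(2) by (auto simp: set_zip)
  show ?thesis using arg_cong[OF *, of "\<lambda>l. l ! i"] i by simp
qed

lemma resolvent_exists:
  assumes "body C = B # R" "pred_of B = pred_of (head K)"
  shows "\<exists>E. resolvent C K E"
proof -
  obtain f where f: "bij f" "clause_vars C \<inter> vren f f ` clause_vars K = {}"
    using fresh_renaming_exists[of "clause_vars C" "clause_vars K"] by auto
  let ?K = "clause_sub (ren f f) K"
  let ?eqs = "zip (args B) (args (head ?K))"
  have "pred_of B = pred_of (head ?K)" using assms(2) by (simp add: clause_sub_def)
  then obtain \<sigma> where "is_mgu \<sigma> {(t, s) \<in> set ?eqs. is_var t \<and> is_var s}"
    using mgu_exists[of "{(t, s) \<in> set ?eqs. is_var t \<and> is_var s}"] zip_same_sorts by blast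
  moreover have "is_renaming (ren f f)" using f by (auto simp: is_renaming_iff)
  moreover have "clause_vars C \<inter> clause_vars ?K = {}" using f by (simp add: clause_vars_ren)
  ultimately show ?thesis using assms unfolding resolvent_def by blast
qed

lemma holds_eq_con:
  "sort_of t = sort_of s \<Longrightarrow> holds_acon v (eq_con t s) \<longleftrightarrow> teval v t = teval v s"
  by (cases t; cases s) auto

lemma ground_eqI:
  assumes "pred_of A = pred_of B"
    and "\<And>t s. (t, s) \<in> set (zip (args A) (args B)) \<Longrightarrow> teval v t = teval v s"
  shows "ground v A = ground v B"
proof -
  have "length (args A) = length (args B)"
    using assms(1) by (metis pred_of_def length_map prod.inject)
  moreover have "teval v (args A ! i) = teval v (args B ! i)" if "i < length (args A)" for i
    using assms(2)[of "args A ! i" "args B ! i"] that calculation by (force simp: set_zip)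
  ultimately have "map (teval v) (args A) = map (teval v) (args B)"
    by (intro nth_equalityI) auto
  then show ?thesis using assms(1) by (simp add: ground_def pred_of_def)
qed

lemma ground_eqD:
  assumes "ground v A = ground v B" "(t, s) \<in> set (zip (args A) (args B))"
  shows "teval v t = teval v s"
proof -
  have *: "map (teval v) (args A) = map (teval v) (args B)" using assms(1) by (simp add: ground_def)
  obtain i where i: "i < length (args A)" "i < length (args B)" "t = args A ! i" "s = args B ! i"
    using assms(2) by (auto simp: set_zip)
  show ?thesis using arg_cong[OF *, of "\<lambda>l. l ! i"] i by simp
qed

lemma holds_append: "holds v (c @ d) \<longleftrightarrow> holds v c \<and> holds v d"
  by (auto simp: holds_def)

lemma def_clause_simps [simp]:
  "head (def_clause p V T) = Atom p (map var_trm V)"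
  "con (def_clause p V T) = []"
  "body (def_clause p V T) = [T]"
  by (simp_all add: def_clause_def)

lemma atom_vars_head_def [simp]: "atom_vars (Atom p (map var_trm V)) = set V"
  by (auto simp: atom_vars_def)

lemma resolvent_sound:
  assumes res: "resolvent (def_clause p V T) K E"
    and con: "holds v (con E)" and body: "\<And>B. B \<in> set (body E) \<Longrightarrow> ground v B \<in> I"
    and K: "K \<in> P" and I: "is_model I P"
  shows "\<exists>u. ground v (head E) = (p, map (\<lambda>x. teval u (var_trm x)) V) \<and> ground u T \<in> I"
proof -
  obtain \<rho> K' eqs \<sigma> where
    pr: "pred_of T = pred_of (head K)" and K': "K' = clause_sub \<rho> K"
    and eqs: "eqs = zip (args T) (args (head K'))"
    and mgu: "is_mgu \<sigma> {(t, s) \<in> set eqs. is_var t \<and> is_var s}"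
    and E: "E = clause_sub \<sigma> (Clause (Atom p (map var_trm V))
                 (map (\<lambda>(t, s). eq_con t s) (filter (\<lambda>(t, s). \<not> (is_var t \<and> is_var s)) eqs) @ con K')
                 (body K'))"
    using res unfolding resolvent_def by auto
  define u where "u = vsub v \<sigma>"
  have pr': "pred_of T = pred_of (head K')" using pr by (simp add: K' clause_sub_def)
  have c: "holds u (con K')"
    and ceq: "holds u (map (\<lambda>(t, s). eq_con t s) (filter (\<lambda>(t, s). \<not> (is_var t \<and> is_var s)) eqs))"
    using con by (simp_all add: E clause_sub_def holds_sub[simplified map_append] u_def holds_append
      flip: map_append)
  have "ground u B \<in> I" if "B \<in> set (body K')" for B
    using body[of "atom_sub \<sigma> B"] that by (simp add: E clause_sub_def ground_sub u_def)
  then have "ground (vsub u \<rho>) B \<in> I" if "B \<in> set (body K)" for B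
    using that by (simp add: K' clause_sub_def flip: ground_sub)
  moreover have "holds (vsub u \<rho>) (con K)"
    using c by (simp add: K' clause_sub_def holds_sub)
  ultimately have "ground (vsub u \<rho>) (head K) \<in> I"
    using I K unfolding is_model_def by blast
  then have hd: "ground u (head K') \<in> I" by (simp add: K' clause_sub_def ground_sub)
  have "ground u T = ground u (head K')"
  proof (rule ground_eqI[OF pr'])
    fix t s assume ts: "(t, s) \<in> set (zip (args T) (args (head K')))"
    show "teval u t = teval u s"
    proof (cases "is_var t \<and> is_var s")
      case True
      then have "tsub \<sigma> t = tsub \<sigma> s"
        using mgu ts by (auto simp: is_mgu_def unifies_def eqs)
      then show ?thesis by (simp add: u_def flip: teval_sub)
    next
      case False
      then have "holds_acon u (eq_con t s)"
        using ceq ts by (auto simp: holds_def eqs)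
      then show ?thesis using zip_same_sorts[OF pr' ts] by (simp add: holds_eq_con)
    qed
  qed
  moreover have "ground v (head E) = (p, map (\<lambda>x. teval u (var_trm x)) V)"
    by (simp add: E clause_sub_def ground_sub u_def) (simp add: ground_def)
  ultimately show ?thesis using hd by metis
qed

lemma resolvent_complete:
  assumes res: "resolvent (def_clause p V T) K E"
    and con: "holds v (con K)" and eq: "ground u T = ground v (head K)"
  shows "\<exists>w. holds w (con E) \<and> ground w ` set (body E) = ground v ` set (body K) \<and>
    ground w (head E) = (p, map (\<lambda>x. teval u (var_trm x)) V)"
proof -
  let ?D = "def_clause p V T"
  obtain \<rho> K' eqs \<sigma> where
    pr: "pred_of T = pred_of (head K)" and \<rho>: "is_renaming \<rho>" and K': "K' = clause_sub \<rho> K"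
    and dis: "clause_vars ?D \<inter> clause_vars K' = {}"
    and eqs: "eqs = zip (args T) (args (head K'))"
    and mgu: "is_mgu \<sigma> {(t, s) \<in> set eqs. is_var t \<and> is_var s}"
    and E: "E = clause_sub \<sigma> (Clause (Atom p (map var_trm V))
                 (map (\<lambda>(t, s). eq_con t s) (filter (\<lambda>(t, s). \<not> (is_var t \<and> is_var s)) eqs) @ con K')
                 (body K'))"
    using res unfolding resolvent_def by auto
  have pr': "pred_of T = pred_of (head K')" using pr by (simp add: K' clause_sub_def)
  obtain f g where fg: "bij f" "bij g" "\<rho> = ren f g" using \<rho> by (auto simp: is_renaming_iff)
  define v' :: valuation where "v' = (fst v \<circ> inv f, snd v \<circ> inv g)"
  have v': "vsub v' \<rho> = v"
    using fg by (cases v) (auto simp: v'_def vsub_def ren_def bij_is_inj)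
  define h where "h x = (if x \<in> clause_vars ?D then teval u (var_trm x) else teval v' (var_trm x))" for x
  define w0 where "w0 = mkval h"
  have w0: "teval w0 (var_trm x) = h x" for x
    using teval_mkval[of h x u "var_trm x"] teval_mkval[of h x v' "var_trm x"]
    by (auto simp: w0_def h_def)
  have aD: "agree (clause_vars ?D) w0 u" by (auto simp: agree_def w0 h_def)
  have aK: "agree (clause_vars K') w0 v'" using dis by (auto simp: agree_def w0 h_def)
  have T: "ground w0 T = ground u T"
    by (rule ground_agree, rule agree_mono[OF aD]) (auto simp: clause_vars_def atoms_vars_def)
  have "ground w0 (head K') = ground v' (head K')"
    by (rule ground_agree, rule agree_mono[OF aK]) (auto simp: clause_vars_def)
  also have "\<dots> = ground v (head K)" by (simp add: K' clause_sub_def ground_sub v')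
  finally have geq: "ground w0 T = ground w0 (head K')" using T eq by simp
  have con': "holds w0 (con K')"
  proof -
    have "holds w0 (con K') = holds v' (con K')"
      by (rule holds_agree, rule agree_mono[OF aK]) (auto simp: clause_vars_def)
    then show ?thesis using con by (simp add: K' clause_sub_def holds_sub v')
  qed
  have sol: "teval w0 t = teval w0 s" if "(t, s) \<in> set eqs" for t s
    using ground_eqD[OF geq] that by (simp add: eqs)
  obtain w where w: "vsub w \<sigma> = w0"
    using solution_factors_mgu[OF mgu, of w0] sol by auto
  have "holds w0 (map (\<lambda>(t, s). eq_con t s) (filter (\<lambda>(t, s). \<not> (is_var t \<and> is_var s)) eqs))"
    using sol zip_same_sorts[OF pr'] unfolding holds_def eqs by (auto simp: holds_eq_con)
  then have "holds w (con E)"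
    using con' by (simp add: E clause_sub_def holds_sub w holds_append flip: map_append)
  moreover have "ground w (atom_sub \<sigma> (atom_sub \<rho> B)) = ground v B" if "B \<in> set (body K)" for B
  proof -
    have "ground w0 (atom_sub \<rho> B) = ground v' (atom_sub \<rho> B)"
      using that by (intro ground_agree agree_mono[OF aK])
        (auto simp: clause_vars_def atoms_vars_def K' clause_sub_def)
    then show ?thesis by (simp add: ground_sub w v')
  qed
  then have "ground w ` set (body E) = ground v ` set (body K)"
    by (simp add: E K' clause_sub_def image_image)
  moreover have "ground w (head E) = (p, map (\<lambda>x. teval u (var_trm x)) V)"
  proof -
    have "teval w0 (var_trm x) = teval u (var_trm x)" if "x \<in> set V" for x
      using that by (simp add: w0 h_def clause_vars_def)
    then show ?thesis by (simp add: E clause_sub_def ground_sub w) (simp add: ground_def)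
  qed
  ultimately show ?thesis by blast
qed


section \<open>Folding\<close>

lemma fold_atom_sound:
  assumes fold: "fold_ok C i V T \<theta>"
    and V: "\<And>x. x \<in> set V \<Longrightarrow> teval v (tsub \<theta> (var_trm x)) = teval u (var_trm x)"
  shows "\<exists>w. agree (rest_vars C i) w v \<and> ground w (body C ! i) = ground u T"
proof -
  let ?X = "atom_vars T - set V"
  have "\<forall>x\<in>?X. \<exists>y. tsub \<theta> (var_trm x) = var_trm y \<and> y \<notin> rest_vars C i \<and>
        (\<forall>z\<in>(atom_vars T \<union> set V) - {x}. y \<notin> tvars (tsub \<theta> (var_trm z)))"
    using fold by (simp add: fold_ok_def)
  then obtain r where r: "\<And>x. x \<in> ?X \<Longrightarrow> tsub \<theta> (var_trm x) = var_trm (r x)"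
    and rest: "\<And>x. x \<in> ?X \<Longrightarrow> r x \<notin> rest_vars C i"
    and sep: "\<And>x z. x \<in> ?X \<Longrightarrow> z \<in> atom_vars T \<union> set V \<Longrightarrow> z \<noteq> x \<Longrightarrow> r x \<notin> tvars (tsub \<theta> (var_trm z))"
    by (auto dest!: bchoice)
  have inj: "inj_on r ?X"
  proof (rule inj_onI, rule ccontr)
    fix x z assume xz: "x \<in> ?X" "z \<in> ?X" "r x = r z" "x \<noteq> z"
    then show False using sep[of x z] r[of z] by auto
  qed
  define h where "h y = (if y \<in> r ` ?X then teval u (var_trm (inv_into ?X r y))
    else teval v (var_trm y))" for y
  define w where "w = mkval h"
  have w_r: "teval w (var_trm (r x)) = teval u (var_trm x)" if x: "x \<in> ?X" for x
  proof -
    have "h (r x) = teval u (var_trm x)" using x inj by (simp add: h_def)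
    moreover have "sort_of (var_trm x) = sort_of (var_trm (r x))"
      using sort_of_tsub[of \<theta> "var_trm x"] r[OF x] by simp
    ultimately show ?thesis using teval_mkval[of h "r x" u "var_trm x"] by (simp add: w_def)
  qed
  have w_v: "teval w (var_trm y) = teval v (var_trm y)" if "y \<notin> r ` ?X" for y
    using that teval_mkval[of h y v "var_trm y"] by (auto simp: w_def h_def)
  have "agree (rest_vars C i) w v"
    unfolding agree_def by (intro ballI w_v) (use rest in auto)
  moreover have "agree (atom_vars T) (vsub w \<theta>) u"
    unfolding agree_def
  proof
    fix z assume z: "z \<in> atom_vars T"
    show "teval (vsub w \<theta>) (var_trm z) = teval u (var_trm z)"
    proof (cases "z \<in> set V")
      case False
      then have "z \<in> ?X" using z by simp
      then show ?thesis unfolding teval_sub[symmetric] by (simp only: r w_r)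
    next
      case True
      have "r x \<notin> tvars (tsub \<theta> (var_trm z))" if "x \<in> ?X" for x
        using sep[OF that, of z] z True that by auto
      then have "agree (tvars (tsub \<theta> (var_trm z))) w v"
        unfolding agree_def by (intro ballI w_v) auto
      then show ?thesis unfolding teval_sub[symmetric] V[OF True, symmetric] by (rule teval_agree)
    qed
  qed
  then have "ground w (body C ! i) = ground u T"
    using fold ground_agree by (simp add: fold_ok_def ground_sub)
  ultimately show ?thesis by blast
qed

lemma combine_local_valuations:
  assumes w: "\<And>i. i < length (body C) \<Longrightarrow> agree (rest_vars C i) (w i) v"
  shows "\<exists>v'. agree (atom_vars (head C) \<union> con_vars (con C)) v' v \<and>
    (\<forall>i<length (body C). ground v' (body C ! i) = ground (w i) (body C ! i))"
proof -
  let ?n = "length (body C)"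
  define own where "own i = atom_vars (body C ! i) - rest_vars C i" for i
  have other: "atom_vars (body C ! j) \<subseteq> rest_vars C i" if "i < ?n" "j < ?n" "i \<noteq> j" for i j
  proof (cases "j < i")
    case True
    then have "body C ! j \<in> set (take i (body C))" using that by (auto simp: in_set_conv_nth)
    then show ?thesis by (auto simp: rest_vars_def atoms_vars_def)
  next
    case False
    then have "drop (Suc i) (body C) ! (j - Suc i) = body C ! j" "j - Suc i < length (drop (Suc i) (body C))"
      using that by auto
    then have "body C ! j \<in> set (drop (Suc i) (body C))" by (metis nth_mem)
    then show ?thesis by (auto simp: rest_vars_def atoms_vars_def)
  qed
  define sel where "sel y = (SOME i. i < ?n \<and> y \<in> own i)" for y
  define h where "h y = (if \<exists>i<?n. y \<in> own i then teval (w (sel y)) (var_trm y)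
    else teval v (var_trm y))" for y
  have h: "teval (mkval h) (var_trm y) = h y" for y
  proof (cases "\<exists>i<?n. y \<in> own i")
    case True
    then have "h y = teval (w (sel y)) (var_trm y)" unfolding h_def by (rule if_P)
    then show ?thesis by (rule teval_mkval) simp
  next
    case False
    then have "h y = teval v (var_trm y)" unfolding h_def by (rule if_not_P)
    then show ?thesis by (rule teval_mkval) simp
  qed
  have "agree (atom_vars (head C) \<union> con_vars (con C)) (mkval h) v"
    unfolding agree_def h by (auto simp: h_def own_def rest_vars_def)
  moreover have "agree (atom_vars (body C ! i)) (mkval h) (w i)" if i: "i < ?n" for i
    unfolding agree_def h
  proof
    fix y assume y: "y \<in> atom_vars (body C ! i)"
    have uniq: "j = i" if "j < ?n" "y \<in> own j" for j
      using other[OF that(1) i] y that(2) unfolding own_def by blast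
    show "h y = teval (w i) (var_trm y)"
    proof (cases "y \<in> own i")
      case True
      then have "sel y = i" unfolding sel_def using i uniq by (intro some_equality) blast+
      moreover have "\<exists>i<?n. y \<in> own i" using True i by blast
      ultimately show ?thesis by (simp add: h_def)
    next
      case False
      then have "\<not> (\<exists>i<?n. y \<in> own i)" using uniq by blast
      then have "h y = teval v (var_trm y)" unfolding h_def by (rule if_not_P)
      moreover have "y \<in> rest_vars C i" using False y by (simp add: own_def)
      ultimately show ?thesis using w[OF i] by (simp add: agree_def)
    qed
  qed
  ultimately show ?thesis using ground_agree by blast
qed

lemma folded_sound:
  assumes fold: "folded_all Defs C C'"
    and I: "\<And>p V T vs. def_clause p V T \<in> Defs \<Longrightarrow> (p, vs) \<in> I \<Longrightarrow>
      \<exists>u. vs = map (\<lambda>x. teval u (var_trm x)) V \<and> ground u T \<in> M"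
    and con: "holds v (con C')" and body: "\<And>B. B \<in> set (body C') \<Longrightarrow> ground v B \<in> I"
  shows "\<exists>v'. holds v' (con C) \<and> (\<forall>B\<in>set (body C). ground v' B \<in> M) \<and>
    ground v' (head C) = ground v (head C')"
proof -
  have len: "length (body C') = length (body C)" and heq: "head C' = head C" and ceq: "con C' = con C"
    using fold by (auto simp: folded_all_def)
  have "\<exists>w. agree (rest_vars C i) w v \<and> ground w (body C ! i) \<in> M" if i: "i < length (body C)" for i
  proof -
    obtain p V T \<theta> where D: "def_clause p V T \<in> Defs" and ok: "fold_ok C i V T \<theta>"
      and b: "body C' ! i = atom_sub \<theta> (Atom p (map var_trm V))"
      using fold i unfolding folded_all_def by blast
    have "ground v (body C' ! i) \<in> I" using body i len by simp
    then have "(p, map (\<lambda>x. teval v (tsub \<theta> (var_trm x))) V) \<in> I"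
      by (simp add: b ground_def atom_sub_def o_def)
    from I[OF D this] obtain u where u: "\<forall>x\<in>set V. teval v (tsub \<theta> (var_trm x)) = teval u (var_trm x)"
      "ground u T \<in> M" by auto
    then show ?thesis using fold_atom_sound[OF ok, of v u] by metis
  qed
  then obtain w where w: "\<And>i. i < length (body C) \<Longrightarrow> agree (rest_vars C i) (w i) v"
    "\<And>i. i < length (body C) \<Longrightarrow> ground (w i) (body C ! i) \<in> M"
    by metis
  from combine_local_valuations[of C w v, OF w(1)] obtain v' where
    v': "agree (atom_vars (head C) \<union> con_vars (con C)) v' v"
    "\<And>i. i < length (body C) \<Longrightarrow> ground v' (body C ! i) = ground (w i) (body C ! i)"
    by blast
  have "ground v' (head C) = ground v (head C')"
    unfolding heq by (rule ground_agree, rule agree_mono[OF v'(1)]) auto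
  moreover have "holds v' (con C) = holds v (con C')"
    unfolding ceq by (rule holds_agree, rule agree_mono[OF v'(1)]) auto
  moreover have "\<forall>B\<in>set (body C). ground v' B \<in> M"
    using v'(2) w(2) by (auto simp: in_set_conv_nth)
  ultimately show ?thesis using con by blast
qed

lemma folded_complete:
  assumes fold: "folded_all Defs C C'"
    and J: "\<And>p V T u. def_clause p V T \<in> Defs \<Longrightarrow> ground u T \<in> J \<Longrightarrow>
      (p, map (\<lambda>x. teval u (var_trm x)) V) \<in> M"
    and body: "\<And>B. B \<in> set (body C) \<Longrightarrow> ground v B \<in> J" and B': "B' \<in> set (body C')"
  shows "ground v B' \<in> M"
proof -
  obtain i where i: "i < length (body C)" "B' = body C' ! i"
    using B' fold by (auto simp: in_set_conv_nth folded_all_def)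
  obtain p V T \<theta> where D: "def_clause p V T \<in> Defs" and ok: "fold_ok C i V T \<theta>"
    and b: "body C' ! i = atom_sub \<theta> (Atom p (map var_trm V))"
    using fold i unfolding folded_all_def by blast
  have "ground (vsub v \<theta>) T \<in> J"
    using body[of "body C ! i"] i ok by (simp add: fold_ok_def ground_sub)
  from J[OF D this] show ?thesis
    by (simp add: i b ground_sub) (simp add: ground_def o_def)
qed

lemma def_clause_eq_iff [simp]:
  "def_clause p V T = def_clause p' V' T' \<longleftrightarrow> p = p' \<and> V = V' \<and> T = T'"
proof -
  have "inj var_trm" by (rule injI) simp
  then show ?thesis by (auto simp: def_clause_def inj_map_eq_map)
qed

lemma foldable_by_variant:
  assumes D: "def_clause q Q T \<in> Defs" and \<theta>: "is_renaming \<theta>" "atom_sub \<theta> (body C ! i) = T"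
    and sub: "(\<Union>x\<in>linkvars C i. tvars (tsub \<theta> (var_trm x))) \<subseteq> set Q"
  shows "foldable Defs C i"
proof -
  obtain f g where fg: "bij f" "bij g" "\<theta> = ren f g" using \<theta> by (auto simp: is_renaming_iff)
  let ?\<theta>' = "ren (inv f) (inv g)"
  have B: "body C ! i = atom_sub ?\<theta>' T"
    using fg \<theta>(2) by (auto simp: atom_sub_ren_ren atom_sub_ren_id bij_is_inj)
  have inj: "inj (vren (inv f) (inv g))"
    using fg by (simp add: inj_vren bij_imp_bij_inv bij_is_inj)
  have "fold_ok C i Q T ?\<theta>'"
    unfolding fold_ok_def
  proof (intro conjI B ballI)
    fix x assume x: "x \<in> atom_vars T - set Q"
    let ?y = "vren (inv f) (inv g) x"
    have "?y \<in> atom_vars (body C ! i)" using x by (simp add: B atom_vars_ren)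
    moreover have "vren f g ?y = x" using fg by (simp add: vren_inv bij_is_surj)
    ultimately have "?y \<notin> rest_vars C i" using sub x by (auto simp: linkvars_def fg)
    then show "\<exists>y. tsub ?\<theta>' (var_trm x) = var_trm y \<and> y \<notin> rest_vars C i \<and>
        (\<forall>z\<in>atom_vars T \<union> set Q - {x}. y \<notin> tvars (tsub ?\<theta>' (var_trm z)))"
      using inj by (intro exI[of _ ?y]) (auto dest: injD)
  qed
  then show ?thesis using D unfolding foldable_def by blast
qed


section \<open>Invariants of the strategy\<close>

definition is_shape :: "clause set \<Rightarrow> atom \<Rightarrow> bool" where
  "is_shape P A \<longleftrightarrow> (\<exists>K\<in>P. \<exists>B\<in>set (body K). \<exists>f g. A = atom_sub (ren f g) B)"

lemma is_shape_preds: "is_shape P A \<Longrightarrow> pred_of A \<in> preds P"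
  by (fastforce simp: is_shape_def preds_def)

lemma is_shape_body: "K \<in> P \<Longrightarrow> B \<in> set (body K) \<Longrightarrow> is_shape P B"
  unfolding is_shape_def by (metis atom_sub_ren_id)

lemma resolvent_is_shape:
  assumes res: "resolvent (def_clause p V T) K E" and "K \<in> P" and B: "B \<in> set (body E)"
  shows "is_shape P B"
proof -
  obtain \<rho> K' eqs \<sigma> where
    pr: "pred_of T = pred_of (head K)" and \<rho>: "is_renaming \<rho>" and K': "K' = clause_sub \<rho> K"
    and eqs: "eqs = zip (args T) (args (head K'))"
    and mgu: "is_mgu \<sigma> {(t, s) \<in> set eqs. is_var t \<and> is_var s}"
    and body: "body E = map (atom_sub \<sigma>) (body K')"
    using res unfolding resolvent_def by (auto simp: clause_sub_def)
  have pr': "pred_of T = pred_of (head K')" using pr by (simp add: K' clause_sub_def)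
  obtain f g where \<sigma>: "\<sigma> = ren f g"
    using mgu_of_vars_is_ren[OF mgu] zip_same_sorts[OF pr'] by (auto simp: eqs)
  obtain f' g' where \<rho>': "\<rho> = ren f' g'" using \<rho> by (auto simp: is_renaming_iff)
  obtain B0 where "B0 \<in> set (body K)" "B = atom_sub (ren (f \<circ> f') (g \<circ> g')) B0"
    using B by (auto simp: body K' clause_sub_def \<sigma> \<rho>' atom_sub_ren_ren)
  then show ?thesis using \<open>K \<in> P\<close> unfolding is_shape_def by blast
qed

text \<open>A definition \<open>newp(V) :- A\<close> is classified by a body atom \<open>B\<close> of the program of which \<open>A\<close> is a
  variable-to-variable instance, together with the variables of \<open>B\<close> that get identified.\<close>

definition shape_keys :: "clause set \<Rightarrow> (atom \<times> (var \<times> var) set) set" where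
  "shape_keys P = (SIGMA B:(\<Union>K\<in>P. set (body K)). Pow (atom_vars B \<times> atom_vars B))"

definition has_key :: "atom \<Rightarrow> atom \<times> (var \<times> var) set \<Rightarrow> bool" where
  "has_key A k \<longleftrightarrow> (\<exists>B f g. A = atom_sub (ren f g) B \<and> k = (B, ker_on (atom_vars B) (vren f g)))"

lemma has_key_exists: "is_shape P A \<Longrightarrow> \<exists>k\<in>shape_keys P. has_key A k"
  unfolding is_shape_def shape_keys_def has_key_def ker_on_def by blast

lemma has_key_variant:
  "has_key A k \<Longrightarrow> has_key A' k \<Longrightarrow> \<exists>\<theta>. is_renaming \<theta> \<and> atom_sub \<theta> A = A'"
  unfolding has_key_def by (metis same_kernel_variant prod.inject)

definition shape_size :: "clause set \<Rightarrow> nat" where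
  "shape_size P = (\<Sum>B\<in>(\<Union>K\<in>P. set (body K)). card (atom_vars B))"

lemma card_vars_shape:
  assumes "finite P" "is_shape P A"
  shows "card (atom_vars A) \<le> shape_size P"
proof -
  obtain K B f g where *: "K \<in> P" "B \<in> set (body K)" "A = atom_sub (ren f g) B"
    using assms(2) by (auto simp: is_shape_def)
  have "card (atom_vars A) \<le> card (atom_vars B)"
    unfolding * atom_vars_ren by (rule card_image_le) simp
  also have "\<dots> \<le> shape_size P"
    unfolding shape_size_def by (rule member_le_sum) (use * assms(1) in auto)
  finally show ?thesis .
qed

definition wf_def :: "clause set \<Rightarrow> clause \<Rightarrow> bool" where
  "wf_def P D \<longleftrightarrow> (\<exists>p V T. D = def_clause p V T \<and> set V \<subseteq> atom_vars T \<and> is_shape P T)"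

definition weight :: "clause \<Rightarrow> nat" where
  "weight D = Suc (card (atom_vars (head D)))"

definition unsafe_clauses :: "clause set \<Rightarrow> clause set" where
  "unsafe_clauses P = {C \<in> P. head C = Atom unsafe []}"

locale nlr_inv =
  fixes P Defs Unf S :: "clause set" and N :: "string set"
  assumes finite_P: "finite P" and finite_Defs: "finite Defs" and finite_Unf: "finite Unf"
    and finite_S: "finite S" and finite_N: "finite N" and unsafe_N: "unsafe \<in> N"
    and wf_defs: "\<And>D. D \<in> Defs \<union> Unf \<Longrightarrow> wf_def P D"
    and names: "\<And>D. D \<in> Defs \<union> Unf \<Longrightarrow> pname (head D) \<in> N - {unsafe}"
    and names_inj: "inj_on (\<lambda>D. pname (head D)) (Defs \<union> Unf)"
    and no_variants: "\<And>D1 D2 \<theta>. D1 \<in> Defs \<Longrightarrow> D2 \<in> Defs \<Longrightarrow> is_renaming \<theta> \<Longrightarrow>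
      atom_sub \<theta> (hd (body D1)) = hd (body D2) \<Longrightarrow> D1 = D2"
    and unsafe_S: "unsafe_clauses P \<subseteq> S"
    and S_origin: "\<And>C. C \<in> S \<Longrightarrow> C \<in> unsafe_clauses P \<or> (\<exists>D\<in>Unf. \<exists>K\<in>P. resolvent D K C)"
    and resolvents_S: "\<And>D K. D \<in> Unf \<Longrightarrow> K \<in> P \<Longrightarrow> pred_of (head K) = pred_of (hd (body D)) \<Longrightarrow>
      \<exists>E\<in>S. resolvent D K E"
begin

lemma S_shape:
  assumes "C \<in> S" "B \<in> set (body C)"
  shows "is_shape P B"
  using S_origin[OF assms(1)]
proof
  assume "C \<in> unsafe_clauses P"
  then show ?thesis using assms(2) by (auto simp: unsafe_clauses_def intro: is_shape_body)
next
  assume "\<exists>D\<in>Unf. \<exists>K\<in>P. resolvent D K C"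
  then obtain D K where *: "D \<in> Unf" "K \<in> P" "resolvent D K C" by blast
  then obtain p V T where "D = def_clause p V T" using wf_defs by (force simp: wf_def_def)
  then show ?thesis using * assms(2) resolvent_is_shape by blast
qed

lemma weight_bound: "(\<Sum>D\<in>Defs. weight D) \<le> card (shape_keys P) * Suc (shape_size P)"
proof -
  have shape: "is_shape P (hd (body D))" "atom_vars (head D) \<subseteq> atom_vars (hd (body D))"
    if "D \<in> Defs" for D
    using wf_defs[of D] that by (auto simp: wf_def_def)
  have "weight D \<le> Suc (shape_size P)" if "D \<in> Defs" for D
    using card_mono[OF _ shape(2)[OF that]] card_vars_shape[OF finite_P shape(1)[OF that]]
    by (simp add: weight_def)
  then have "(\<Sum>D\<in>Defs. weight D) \<le> card Defs * Suc (shape_size P)"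
    using sum_bounded_above[of Defs weight "Suc (shape_size P)"] by simp
  moreover have "card Defs \<le> card (shape_keys P)"
  proof -
    have "\<forall>D\<in>Defs. \<exists>k\<in>shape_keys P. has_key (hd (body D)) k"
      using has_key_exists shape(1) by blast
    then obtain k where k: "\<forall>D\<in>Defs. k D \<in> shape_keys P \<and> has_key (hd (body D)) (k D)"
      by metis
    have "inj_on k Defs"
      by (rule inj_onI) (metis k has_key_variant no_variants)
    moreover have "k ` Defs \<subseteq> shape_keys P" using k by auto
    moreover have "finite (shape_keys P)" using finite_P by (auto simp: shape_keys_def)
    ultimately show ?thesis by (rule card_inj_on_le)
  qed
  ultimately show ?thesis by (meson le_trans mult_le_mono1)
qed

lemma inv_unfold:
  assumes D: "D \<in> Defs" and U: "unfold_result P D U"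
  shows "nlr_inv P Defs (insert D Unf) (S \<union> U) N"
proof -
  obtain g where g: "U = g ` {K \<in> P. pred_of (head K) = pred_of (hd (body D))}"
    "\<And>K. K \<in> P \<Longrightarrow> pred_of (head K) = pred_of (hd (body D)) \<Longrightarrow> resolvent D K (g K)"
    using U unfolding unfold_result_def by blast
  have eq: "Defs \<union> insert D Unf = Defs \<union> Unf" using D by auto
  show ?thesis
  proof (unfold_locales, unfold eq)
    show "finite (S \<union> U)" using finite_S finite_P g by simp
    show "C \<in> unsafe_clauses P \<or> (\<exists>D\<in>insert D Unf. \<exists>K\<in>P. resolvent D K C)"
      if "C \<in> S \<union> U" for C
      using that S_origin[of C] g by auto
    show "\<exists>E\<in>S \<union> U. resolvent D' K E"
      if "D' \<in> insert D Unf" "K \<in> P" "pred_of (head K) = pred_of (hd (body D'))" for D' K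
      using that resolvents_S[of D' K] g by auto
  qed (use finite_P finite_Defs finite_Unf finite_N unsafe_N wf_defs names names_inj no_variants
        unsafe_S in auto)
qed

lemma inv_insert_def:
  assumes Ds: "Ds \<subseteq> Defs" and p: "p \<notin> N" and V: "set V \<subseteq> atom_vars T" "is_shape P T"
    and new: "\<And>D \<theta>. D \<in> Ds \<Longrightarrow> is_renaming \<theta> \<Longrightarrow> atom_sub \<theta> T \<noteq> hd (body D)"
  shows "nlr_inv P (insert (def_clause p V T) Ds) Unf S (insert p N)"
proof -
  let ?D = "def_clause p V T"
  have new': "atom_sub \<theta> (hd (body D)) \<noteq> T" if "D \<in> Ds" "is_renaming \<theta>" for D \<theta>
    using new that renaming_inverse by metis
  have names': "pname (head D) \<noteq> p" if "D \<in> Ds \<union> Unf" for D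
    using names[of D] that p Ds by auto
  have sub: "Ds \<union> Unf \<subseteq> Defs \<union> Unf" using Ds by auto
  have inj: "inj_on (\<lambda>D. pname (head D)) (Ds \<union> Unf)" using names_inj sub by (rule inj_on_subset)
  show ?thesis
  proof unfold_locales
    show "wf_def P D" if "D \<in> insert ?D Ds \<union> Unf" for D
      using that wf_defs sub V by (auto simp: wf_def_def[of P ?D])
    show "pname (head D) \<in> insert p N - {unsafe}" if "D \<in> insert ?D Ds \<union> Unf" for D
      using that names sub p unsafe_N by fastforce
    show "inj_on (\<lambda>D. pname (head D)) (insert ?D Ds \<union> Unf)"
      using inj names' by (auto simp: inj_on_insert)
    show "D1 = D2" if "D1 \<in> insert ?D Ds" "D2 \<in> insert ?D Ds" "is_renaming \<theta>"
      "atom_sub \<theta> (hd (body D1)) = hd (body D2)" for D1 D2 \<theta>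
    proof -
      have "hd (body ?D) = T" by simp
      then show ?thesis
        using that new[OF _ that(3)] new'[OF _ that(3)] no_variants[OF _ _ that(3)] Ds
        by (metis insertE subsetD)
    qed
  qed (use finite_P finite_Defs finite_Unf finite_S finite_N unsafe_N unsafe_S S_origin
        resolvents_S finite_subset[OF Ds] in auto)
qed

lemma new_def_notin: "p \<notin> N \<Longrightarrow> def_clause p V T \<notin> Defs"
  using names by fastforce

lemma inv_add:
  assumes "C \<in> S" "i < length (body C)" "p \<notin> N" "set V = linkvars C i"
    and new: "\<nexists>q Q T \<theta>. def_clause q Q T \<in> Defs \<and> is_renaming \<theta> \<and> atom_sub \<theta> (body C ! i) = T"
  shows "nlr_inv P (insert (def_clause p V (body C ! i)) Defs) Unf S (insert p N)"
proof (rule inv_insert_def)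
  show "is_shape P (body C ! i)" using assms S_shape by simp
  show "set V \<subseteq> atom_vars (body C ! i)" using assms by (simp add: linkvars_def)
  show "atom_sub \<theta> (body C ! i) \<noteq> hd (body D)" if "D \<in> Defs" "is_renaming \<theta>" for D \<theta>
  proof -
    obtain q Q T where "D = def_clause q Q T" using wf_defs[of D] \<open>D \<in> Defs\<close> unfolding wf_def_def by blast
    then show ?thesis using that new by (metis def_clause_simps(3) list.sel(1))
  qed
qed (use assms in auto)

lemma inv_merge:
  assumes "C \<in> S" "i < length (body C)" "p \<notin> N"
    and D: "def_clause q Q T \<in> Defs" and \<theta>: "is_renaming \<theta>" "atom_sub \<theta> (body C ! i) = T"
    and L: "set L = (\<Union>x\<in>linkvars C i. tvars (tsub \<theta> (var_trm x))) \<union> set Q"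
  shows "nlr_inv P (insert (def_clause p L T) (Defs - {def_clause q Q T})) Unf S (insert p N)"
proof (rule inv_insert_def)
  have Q: "set Q \<subseteq> atom_vars T" and "is_shape P T"
    using wf_defs[of "def_clause q Q T"] D by (auto simp: wf_def_def)
  then show "is_shape P T" by simp
  show "set L \<subseteq> atom_vars T"
    using Q unfolding L \<theta>(2)[symmetric] atom_vars_sub by (auto simp: linkvars_def)
  show "atom_sub \<theta>' T \<noteq> hd (body D')"
    if "D' \<in> Defs - {def_clause q Q T}" "is_renaming \<theta>'" for D' \<theta>'
    using no_variants[of "def_clause q Q T" D' \<theta>'] D that by auto
qed (use assms in auto)

lemma weight_merge:
  assumes "p \<notin> N" and nf: "\<not> foldable Defs C i"
    and D: "def_clause q Q T \<in> Defs" and \<theta>: "is_renaming \<theta>" "atom_sub \<theta> (body C ! i) = T"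
    and L: "set L = (\<Union>x\<in>linkvars C i. tvars (tsub \<theta> (var_trm x))) \<union> set Q"
  shows "(\<Sum>D\<in>Defs. weight D) <
    (\<Sum>D\<in>insert (def_clause p L T) (Defs - {def_clause q Q T}). weight D)"
proof -
  have "set Q \<subset> set L"
    using foldable_by_variant[OF D \<theta>] nf L by auto
  then have "card (set Q) < card (set L)" by (simp add: psubset_card_mono)
  then have "weight (def_clause q Q T) < weight (def_clause p L T)" by (simp add: weight_def)
  moreover have "(\<Sum>D\<in>Defs. weight D) =
    weight (def_clause q Q T) + (\<Sum>D\<in>Defs - {def_clause q Q T}. weight D)"
    using finite_Defs D by (rule sum.remove)
  ultimately show ?thesis
    using finite_Defs new_def_notin[OF assms(1)] by simp
qed

lemma not_final_step:
  assumes "\<not> Defs \<subseteq> Unf \<or> (\<exists>C\<in>S. \<exists>i<length (body C). \<not> foldable Defs C i)"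
  shows "\<exists>s'. nlr_step P (Defs, Unf, S, N) s'"
  using assms
proof
  assume "\<not> Defs \<subseteq> Unf"
  then obtain D where D: "D \<in> Defs" "D \<notin> Unf" by blast
  then obtain p V T where D': "D = def_clause p V T" using wf_defs by (force simp: wf_def_def)
  define g where "g K = (SOME E. resolvent D K E)" for K
  have "resolvent D K (g K)" if "pred_of (head K) = pred_of (hd (body D))" for K
    unfolding g_def using resolvent_exists[of D T "[]" K] that by (auto simp: D' intro: someI_ex)
  then have "unfold_result P D (g ` {K \<in> P. pred_of (head K) = pred_of (hd (body D))})"
    unfolding unfold_result_def by blast
  from nlr_step.unfold[OF D this] show ?thesis by blast
next
  assume "\<exists>C\<in>S. \<exists>i<length (body C). \<not> foldable Defs C i"
  then obtain C i where C: "C \<in> S" "i < length (body C)" "\<not> foldable Defs C i" by blast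
  have pr: "pred_of (body C ! i) \<in> preds P" using C S_shape is_shape_preds by simp
  obtain p where p: "p \<notin> N"
    using ex_new_if_finite[OF infinite_UNIV_listI finite_N] by blast
  show ?thesis
  proof (cases "\<exists>q Q T \<theta>. def_clause q Q T \<in> Defs \<and> is_renaming \<theta> \<and> atom_sub \<theta> (body C ! i) = T")
    case True
    then obtain q Q T \<theta> where D: "def_clause q Q T \<in> Defs" "is_renaming \<theta>" "atom_sub \<theta> (body C ! i) = T"
      by blast
    obtain L where "set L = (\<Union>x\<in>linkvars C i. tvars (tsub \<theta> (var_trm x))) \<union> set Q" "distinct L"
      using finite_distinct_list[of "(\<Union>x\<in>linkvars C i. tvars (tsub \<theta> (var_trm x))) \<union> set Q"] by auto
    from nlr_step.merge_def[OF C(1,2) refl pr C(3) p D this(2,1)] show ?thesis by blast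
  next
    case False
    obtain V where "set V = linkvars C i" "distinct V"
      using finite_distinct_list[of "linkvars C i"] by auto
    from nlr_step.add_def[OF C(1,2) refl pr C(3) p this(2,1) False] show ?thesis by blast
  qed
qed

end

definition nlr_inv_state :: "clause set \<Rightarrow> nlr_state \<Rightarrow> bool" where
  "nlr_inv_state P s \<longleftrightarrow> (case s of (Defs, Unf, S, N) \<Rightarrow> nlr_inv P Defs Unf S N)"

definition nlr_measure :: "clause set \<Rightarrow> nlr_state \<Rightarrow> nat \<times> nat" where
  "nlr_measure P s = (case s of (Defs, Unf, S, N) \<Rightarrow>
     (card (shape_keys P) * Suc (shape_size P) - (\<Sum>D\<in>Defs. weight D), card (Defs - Unf)))"

lemma nlr_inv_init:
  assumes "finite P"
  shows "nlr_inv_state P (nlr_init P)"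
proof -
  have "finite (preds P)" using assms by (simp add: preds_def)
  then show ?thesis
    using assms unfolding nlr_inv_state_def nlr_init_def
    by (auto simp: unsafe_clauses_def intro!: nlr_inv.intro)
qed

lemma nlr_step_inv_decreases:
  assumes "nlr_step P s s'" "nlr_inv_state P s"
  shows "nlr_inv_state P s' \<and> (nlr_measure P s', nlr_measure P s) \<in> less_than <*lex*> less_than"
  using assms
proof (induction rule: nlr_step.induct)
  case (unfold D Defs Unf U S N)
  then interpret nlr_inv P Defs Unf S N by (simp add: nlr_inv_state_def)
  have "Defs - insert D Unf \<subset> Defs - Unf" using unfold by auto
  then have "card (Defs - insert D Unf) < card (Defs - Unf)"
    using finite_Defs by (simp add: psubset_card_mono)
  then show ?case
    using inv_unfold unfold by (simp add: nlr_inv_state_def nlr_measure_def)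
next
  case (add_def C S i B Defs newp N V Unf)
  then interpret nlr_inv P Defs Unf S N by (simp add: nlr_inv_state_def)
  interpret new: nlr_inv P "insert (def_clause newp V B) Defs" Unf S "insert newp N"
    using inv_add[of C i newp V] add_def by simp
  have "(\<Sum>D\<in>Defs. weight D) < (\<Sum>D\<in>insert (def_clause newp V B) Defs. weight D)"
    using finite_Defs new_def_notin[OF \<open>newp \<notin> N\<close>] by (simp add: weight_def)
  then show ?case
    using diff_less_mono2[OF _ less_le_trans[OF _ new.weight_bound]] new.nlr_inv_axioms
    by (simp add: nlr_inv_state_def nlr_measure_def del: sum.insert mult_Suc_right)
next
  case (merge_def C S i B Defs newp N newq Q T \<theta> L Unf)
  then interpret nlr_inv P Defs Unf S N by (simp add: nlr_inv_state_def)
  interpret new: nlr_inv P "insert (def_clause newp L T) (Defs - {def_clause newq Q T})"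
    Unf S "insert newp N"
    using inv_merge[of C i newp newq Q T \<theta> L] merge_def by simp
  have "(\<Sum>D\<in>Defs. weight D) <
    (\<Sum>D\<in>insert (def_clause newp L T) (Defs - {def_clause newq Q T}). weight D)"
    using weight_merge[of newp C i newq Q T \<theta> L] merge_def by simp
  then show ?case
    using diff_less_mono2[OF _ less_le_trans[OF _ new.weight_bound]] new.nlr_inv_axioms
    by (simp add: nlr_inv_state_def nlr_measure_def del: sum.insert mult_Suc_right)
qed

lemma nlr_inv_reachable:
  assumes "(nlr_step P)\<^sup>*\<^sup>* s s'" "nlr_inv_state P s"
  shows "nlr_inv_state P s'"
  using assms by (induction rule: rtranclp_induct) (auto dest: nlr_step_inv_decreases)

lemma stuck_state_has_result:
  assumes "nlr_inv_state P s" "\<nexists>s'. nlr_step P s s'"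
  shows "\<exists>P'. nlr_result s P'"
proof -
  obtain Defs Unf S N where s: "s = (Defs, Unf, S, N)" by (cases s)
  interpret nlr_inv P Defs Unf S N using assms(1) by (simp add: s nlr_inv_state_def)
  have sub: "Defs \<subseteq> Unf" and fold: "\<And>C i. C \<in> S \<Longrightarrow> i < length (body C) \<Longrightarrow> foldable Defs C i"
    using not_final_step assms(2) unfolding s by blast+
  have "\<exists>C'. folded_all Defs C C'" if "C \<in> S" for C
  proof -
    have "\<exists>b. \<exists>newp V T \<theta>. def_clause newp V T \<in> Defs \<and> fold_ok C i V T \<theta> \<and>
      b = atom_sub \<theta> (Atom newp (map var_trm V))" if "i < length (body C)" for i
      using fold[OF \<open>C \<in> S\<close> that] unfolding foldable_def by blast
    then obtain b where b: "\<And>i. i < length (body C) \<Longrightarrow> \<exists>newp V T \<theta>. def_clause newp V T \<in> Defs \<and>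
      fold_ok C i V T \<theta> \<and> b i = atom_sub \<theta> (Atom newp (map var_trm V))" by metis
    then have "folded_all Defs C (Clause (head C) (con C) (map b [0..<length (body C)]))"
      by (simp add: folded_all_def)
    then show ?thesis by blast
  qed
  then obtain f where "\<forall>C\<in>S. folded_all Defs C (f C)" by metis
  then show ?thesis using sub unfolding s nlr_result_def by auto
qed

lemma nlr_terminates_finite:
  assumes "finite P"
  shows "nlr_terminates P"
proof -
  have wf: "wf (less_than <*lex*> less_than)" by auto
  have "\<not> (\<exists>r. r 0 = nlr_init P \<and> (\<forall>n. nlr_step P (r n) (r (Suc n))))"
  proof
    assume "\<exists>r. r 0 = nlr_init P \<and> (\<forall>n. nlr_step P (r n) (r (Suc n)))"
    then obtain r where r: "r 0 = nlr_init P" "\<And>n. nlr_step P (r n) (r (Suc n))" by blast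
    have inv: "nlr_inv_state P (r n)" for n
    proof (induction n)
      case 0
      then show ?case using r(1) nlr_inv_init[OF assms] by simp
    next
      case (Suc n)
      then show ?case using nlr_step_inv_decreases[OF r(2)] by blast
    qed
    have "(nlr_measure P (r (Suc n)), nlr_measure P (r n)) \<in> less_than <*lex*> less_than" for n
      using nlr_step_inv_decreases[OF r(2) inv] by blast
    then show False using wf unfolding wf_iff_no_infinite_down_chain by meson
  qed
  moreover have "\<exists>P'. nlr_result s P'"
    if "(nlr_step P)\<^sup>*\<^sup>* (nlr_init P) s" "\<nexists>s'. nlr_step P s s'" for s
    using stuck_state_has_result nlr_inv_reachable[OF that(1) nlr_inv_init[OF assms]] that(2) by blast
  ultimately show ?thesis unfolding nlr_terminates_def by blast
qed

lemma stuck_state_reachable: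
  assumes "nlr_inv_state P s"
  shows "\<exists>s'. (nlr_step P)\<^sup>*\<^sup>* s s' \<and> (\<nexists>s''. nlr_step P s' s'')"
proof -
  have "wf (inv_image (less_than <*lex*> less_than) (nlr_measure P))" by (rule wf_inv_image) auto
  then show ?thesis
    using assms
  proof (induction s rule: wf_induct_rule)
    case (less s)
    show ?case
    proof (cases "\<exists>s'. nlr_step P s s'")
      case True
      then obtain s' where s': "nlr_step P s s'" by blast
      then obtain s'' where "(nlr_step P)\<^sup>*\<^sup>* s' s''" "\<nexists>t. nlr_step P s'' t"
        using less.IH[of s'] nlr_step_inv_decreases[OF s' less.prems] by auto
      then show ?thesis using s' by (meson converse_rtranclp_into_rtranclp)
    next
      case False
      then show ?thesis by blast
    qed
  qed
qed


section \<open>Preservation of the least model\<close>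

lemma least_model_is_model: "is_model (least_model P) P"
  unfolding is_model_def least_model_def by blast

lemma least_model_subset: "is_model I P \<Longrightarrow> least_model P \<subseteq> I"
  by (auto simp: least_model_def)

lemma ground_eq_unsafe_iff: "ground v A = (unsafe, []) \<longleftrightarrow> A = Atom unsafe []"
  by (cases A) (auto simp: ground_def)

context nlr_inv
begin

text \<open>Clauses obtained from definitions that were merged away stay in the output, so the model
  interprets every definition ever unfolded, not only those in \<open>Defs\<close>.\<close>

lemma result_sound:
  assumes sub: "Defs \<subseteq> Unf" and f: "\<And>C. C \<in> S \<Longrightarrow> folded_all Defs C (f C)"
    and uns: "(unsafe, []) \<in> least_model (f ` S)"
  shows "(unsafe, []) \<in> least_model P"
proof -
  let ?M = "least_model P"
  define I where "I = {(unsafe, vs) |vs. (unsafe, vs) \<in> ?M} \<union>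
    {(p, map (\<lambda>x. teval u (var_trm x)) V) |p V T u. def_clause p V T \<in> Unf \<and> ground u T \<in> ?M}"
  have not_unsafe: "p \<noteq> unsafe" if "def_clause p V T \<in> Unf" for p V T
    using names[of "def_clause p V T"] that by auto
  have I: "\<exists>u. vs = map (\<lambda>x. teval u (var_trm x)) V \<and> ground u T \<in> ?M"
    if D: "def_clause p V T \<in> Defs" and vs: "(p, vs) \<in> I" for p V T vs
  proof -
    have DU: "def_clause p V T \<in> Unf" using D sub by auto
    then obtain V' T' u where *: "def_clause p V' T' \<in> Unf" "ground u T' \<in> ?M"
      "vs = map (\<lambda>x. teval u (var_trm x)) V'"
      using vs not_unsafe by (auto simp: I_def)
    then have "def_clause p V T = def_clause p V' T'"
      using DU by (intro inj_onD[OF names_inj]) auto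
    then show ?thesis using *(2,3) by (metis def_clause_eq_iff)
  qed
  have "is_model I (f ` S)"
    unfolding is_model_def
  proof (intro ballI allI impI)
    fix C' v assume "C' \<in> f ` S" and hyp: "holds v (con C') \<and> (\<forall>B\<in>set (body C'). ground v B \<in> I)"
    then obtain C where C: "C \<in> S" "C' = f C" by blast
    obtain v' where v': "holds v' (con C)" "\<forall>B\<in>set (body C). ground v' B \<in> ?M"
      "ground v' (head C) = ground v (head C')"
      using folded_sound[OF f[OF C(1)], of I ?M v] I hyp C(2) by blast
    from S_origin[OF C(1)] show "ground v (head C') \<in> I"
    proof
      assume "C \<in> unsafe_clauses P"
      then have "C \<in> P" "head C = Atom unsafe []" by (auto simp: unsafe_clauses_def)
      moreover from this have "ground v' (head C) \<in> ?M"
        using v'(1,2) least_model_is_model[of P] unfolding is_model_def by blast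
      ultimately show ?thesis using v'(3) by (auto simp: I_def ground_def)
    next
      assume "\<exists>D\<in>Unf. \<exists>K\<in>P. resolvent D K C"
      then obtain D K where D: "D \<in> Unf" "K \<in> P" "resolvent D K C" by blast
      then obtain p V T where DT: "D = def_clause p V T" using wf_defs by (force simp: wf_def_def)
      obtain u where u: "ground v' (head C) = (p, map (\<lambda>x. teval u (var_trm x)) V)" "ground u T \<in> ?M"
        using resolvent_sound[of p V T K C v' ?M P] D DT v' least_model_is_model by blast
      have "(p, map (\<lambda>x. teval u (var_trm x)) V) \<in> I"
        unfolding I_def using D(1)[unfolded DT] u(2) by blast
      then show ?thesis using v'(3) u(1) by simp
    qed
  qed
  then have "(unsafe, []) \<in> I" using uns least_model_subset by blast
  then show ?thesis using not_unsafe by (auto simp: I_def)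
qed

lemma result_complete:
  assumes sub: "Defs \<subseteq> Unf" and f: "\<And>C. C \<in> S \<Longrightarrow> folded_all Defs C (f C)"
    and uns: "(unsafe, []) \<in> least_model P"
  shows "(unsafe, []) \<in> least_model (f ` S)"
proof -
  let ?M = "least_model (f ` S)"
  define J where "J = {A. (A = (unsafe, []) \<longrightarrow> A \<in> ?M) \<and>
    (\<forall>p V T u. def_clause p V T \<in> Defs \<and> ground u T = A \<longrightarrow>
      (p, map (\<lambda>x. teval u (var_trm x)) V) \<in> ?M)}"
  have J: "(p, map (\<lambda>x. teval u (var_trm x)) V) \<in> ?M"
    if "def_clause p V T \<in> Defs" "ground u T \<in> J" for p V T u
    using that unfolding J_def by blast
  have step: "ground v (head C) \<in> ?M"
    if "C \<in> S" "holds v (con C)" "\<And>B. B \<in> set (body C) \<Longrightarrow> ground v B \<in> J" for C v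
  proof -
    have "\<forall>B\<in>set (body (f C)). ground v B \<in> ?M"
      using folded_complete[OF f[OF that(1)], of J ?M v] J that(3) by blast
    moreover have "con (f C) = con C" "head (f C) = head C"
      using f[OF that(1)] by (auto simp: folded_all_def)
    ultimately show ?thesis
      using that(1,2) least_model_is_model[of "f ` S"] unfolding is_model_def by (metis imageI)
  qed
  have "is_model J P"
    unfolding is_model_def
  proof (intro ballI allI impI)
    fix K v assume K: "K \<in> P" and hyp: "holds v (con K) \<and> (\<forall>B\<in>set (body K). ground v B \<in> J)"
    have "ground v (head K) \<in> ?M" if "ground v (head K) = (unsafe, [])"
    proof -
      have "K \<in> S"
        using that K unsafe_S by (auto simp: ground_eq_unsafe_iff unsafe_clauses_def)
      then show ?thesis using step hyp by blast
    qed
    moreover have "(p, map (\<lambda>x. teval u (var_trm x)) V) \<in> ?M"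
      if D: "def_clause p V T \<in> Defs" and eq: "ground u T = ground v (head K)" for p V T u
    proof -
      obtain E where E: "E \<in> S" "resolvent (def_clause p V T) K E"
        using resolvents_S[of "def_clause p V T" K] D sub K ground_eq_pred_of[OF eq] by auto
      obtain w where w: "holds w (con E)" "ground w ` set (body E) = ground v ` set (body K)"
        "ground w (head E) = (p, map (\<lambda>x. teval u (var_trm x)) V)"
        using resolvent_complete[OF E(2) _ eq] hyp by blast
      have "ground w B \<in> J" if "B \<in> set (body E)" for B
        using w(2) that hyp by (metis (no_types, lifting) imageE imageI)
      then show ?thesis using step[OF E(1) w(1)] w(3) by simp
    qed
    ultimately show "ground v (head K) \<in> J" unfolding J_def by blast
  qed
  then show ?thesis using uns least_model_subset unfolding J_def by blast
qed

end

lemma nlr_output_correct: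
  assumes "finite P" "nlr_output P P'"
  shows "finite P' \<and> ((unsafe, []) \<in> least_model P \<longleftrightarrow> (unsafe, []) \<in> least_model P')"
proof -
  obtain Defs Unf S N where reach: "(nlr_step P)\<^sup>*\<^sup>* (nlr_init P) (Defs, Unf, S, N)"
    and res: "nlr_result (Defs, Unf, S, N) P'"
    using assms(2) by (auto simp: nlr_output_def)
  interpret nlr_inv P Defs Unf S N
    using nlr_inv_reachable[OF reach nlr_inv_init[OF assms(1)]] by (simp add: nlr_inv_state_def)
  obtain f where "Defs \<subseteq> Unf" "P' = f ` S" "\<And>C. C \<in> S \<Longrightarrow> folded_all Defs C (f C)"
    using res by (auto simp: nlr_result_def)
  then show ?thesis using result_sound result_complete finite_S by blast
qed

theorem theorem1:
  fixes Prog :: "clause set"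
  assumes "clp_program Prog"
    and "(unsafe, []) \<in> preds Prog"
  shows "nlr_terminates Prog
    \<and> (\<exists>Prog'. nlr_output Prog Prog')
    \<and> (\<forall>Prog'. nlr_output Prog Prog' \<longrightarrow>
         clp_program Prog' \<and>
         ((unsafe, []) \<in> least_model Prog \<longleftrightarrow> (unsafe, []) \<in> least_model Prog'))"
proof (intro conjI)
  have fin: "finite Prog" using assms(1) by (simp add: clp_program_def)
  show "nlr_terminates Prog" using fin by (rule nlr_terminates_finite)
  obtain s where s: "(nlr_step Prog)\<^sup>*\<^sup>* (nlr_init Prog) s" "\<nexists>s'. nlr_step Prog s s'"
    using stuck_state_reachable[OF nlr_inv_init[OF fin]] by blast
  then show "\<exists>Prog'. nlr_output Prog Prog'"
    using stuck_state_has_result nlr_inv_reachable[OF s(1) nlr_inv_init[OF fin]]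
    unfolding nlr_output_def by blast
  show "\<forall>Prog'. nlr_output Prog Prog' \<longrightarrow> clp_program Prog' \<and>
      ((unsafe, []) \<in> least_model Prog \<longleftrightarrow> (unsafe, []) \<in> least_model Prog')"
    using nlr_output_correct[OF fin] by (simp add: clp_program_def)
qed

end
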